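(* Let $n$ be a positive integer. For every integer $m$ with $1\le m\le n$ there exist $\alpha,\alpha_0,\alpha_1,\dots,\alpha_{m-1}\in\mathbb{R}$ such that $$E_{m+1,n+1}(x)=(2x+1)\,\alpha\,E_{m,n+1}(x)+\sum_{i=0}^{m-1}\alpha_i\,E_{m-i,n+i}(x),$$ where $E_{m,n}$ denotes the Ehrhart polynomial of the symmetric edge polytope of the complete bipartite graph $K_{m,n}$.
   Context: For a finite graph $G=(V,E)$ the symmetric edge polytope is $P_G=\mathrm{conv}\{\pm(e_v-e_w):\{v,w\}\in E\}\subset\mathbb{R}^{|V|}$, where $(e_v)_{v\in V}$ is the standard basis. The Ehrhart polynomial of a lattice polytope $P\subset\mathbb{R}^N$ is the polynomial $E_P$ with $E_P(k)=|kP\cap\mathbb{Z}^N|$ for all $k\in\mathbb{N}$. *)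

theory Defs
  imports
    "HOL-Analysis.Analysis"
    "HOL-Analysis.Finite_Function_Topology"
    "HOL-Computational_Algebra.Polynomial"
begin

text \<open>
  The graphs in question have vertex sets of varying size, so vectors indexed by vertices are
  finitely supported functions \<^typ>\<open>'v \<Rightarrow>\<^sub>0 real\<close>; the Euclidean space on a finite vertex set is
  the subspace of vectors supported there. Dilates of a polytope in this subspace stay in it, so
  counting their integer points does not depend on the ambient space.
\<close>

text \<open>
  A simple graph enters through its set of edges \<open>{v, w}\<close>: isolated vertices only enlarge the
  ambient space.
\<close>

definition symmetric_edge_polytope :: "'v set set \<Rightarrow> ('v \<Rightarrow>\<^sub>0 real) set" where
  "symmetric_edge_polytope E =
     convex hull (\<Union>(v, w)\<in>{(v, w). {v, w} \<in> E}.
       {Poly_Mapping.single v 1 - Poly_Mapping.single w 1,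
        - (Poly_Mapping.single v 1 - Poly_Mapping.single w 1)})"

definition integer_points :: "('v \<Rightarrow>\<^sub>0 real) set" where
  "integer_points = {x. \<forall>v. Poly_Mapping.lookup x v \<in> \<int>}"

definition is_ehrhart_polynomial :: "('v \<Rightarrow>\<^sub>0 real) set \<Rightarrow> real poly \<Rightarrow> bool" where
  "is_ehrhart_polynomial P p \<longleftrightarrow>
     (\<forall>k::nat. poly p (real k) = real (card ((\<lambda>x. real k *\<^sub>R x) ` P \<inter> integer_points)))"

lemma is_ehrhart_polynomial_unique:
  assumes "is_ehrhart_polynomial P p" and "is_ehrhart_polynomial P q"
  shows "p = q"
proof (rule poly_eqI_degree)
  show "poly p x = poly q x" if "x \<in> real ` {..degree p + degree q}" for x
    using that assms by (auto simp: is_ehrhart_polynomial_def)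
qed (simp_all add: card_image)

definition ehrhart_polynomial :: "('v \<Rightarrow>\<^sub>0 real) set \<Rightarrow> real poly" where
  "ehrhart_polynomial P = (THE p. is_ehrhart_polynomial P p)"

definition complete_bipartite_edges :: "nat \<Rightarrow> nat \<Rightarrow> (nat + nat) set set" where
  "complete_bipartite_edges m n = {{Inl i, Inr j} | i j. i < m \<and> j < n}"

definition ehrhart_K :: "nat \<Rightarrow> nat \<Rightarrow> real poly" where
  "ehrhart_K m n = ehrhart_polynomial (symmetric_edge_polytope (complete_bipartite_edges m n))"

end

theory Submission
  imports Defs "HOL-Computational_Algebra.Polynomial_FPS"
begin

text \<open>
  A lattice point of the \<open>k\<close>-th dilate for \<open>K\<^bsub>m+1,n+1\<^esub>\<close> is a pair of integer vectors
  \<open>a \<in> \<int>\<^bsup>m+1\<^esup>\<close>, \<open>b \<in> \<int>\<^bsup>n+1\<^esup>\<close> with the same sum and with \<open>\<ell>\<^sup>1\<close>-norms at most \<open>k\<close>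
  (\<open>lattice_points_eq\<close>): such a pair is a flow problem on the bipartite graph, and unit flows can be
  peeled off along edges one at a time.

  The number of vectors in \<open>\<int>\<^bsup>m+1\<^esup>\<close> with sum \<open>p - q\<close> and norm at most \<open>p + q\<close> satisfies a three-term
  recurrence in \<open>m\<close> in which \<open>p - q\<close> enters only through its square (\<open>slice_count_recurrence\<close>).
  Multiplication by \<open>(p - q)\<^sup>2\<close> acts symmetrically on both factors of a product of two such counts, so
  eliminating it gives a recurrence for the sums over \<open>p + q = k\<close>. It determines the generating function
  of these sums as
  \<open>(1+t)\<^bsup>m+n\<^esup> / (1-t)\<^bsup>m+n+2\<^esup> \<cdot> R\<^bsub>m,n\<^esub>(4t/(1+t)\<^sup>2)\<close> with
  \<open>R\<^bsub>m,n\<^esub>(y) = \<Sum>\<^sub>i (2i choose i) (m choose i) (n choose i) (y/4)\<^sup>i\<close>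
  (\<open>parity_series_eq\<close>). Splitting by the parity of \<open>k\<close> minus the sum, the Ehrhart series is this
  multiplied by \<open>1 + t\<close>; in particular the \<open>h\<^sup>*\<close>-polynomial is palindromic with
  \<open>\<gamma>\<close>-polynomial \<open>R\<^bsub>m,n\<^esub>(4y)\<close>.

  In this picture the asserted relation is one between polynomials in \<open>y\<close>. Multiplying an Ehrhart
  polynomial by \<open>2x + 1\<close> becomes a first-order differential operator on its \<open>\<gamma>\<close>-side
  (\<open>ehrhart_series_deriv\<close>), and raising \<open>m + n\<close> by two without changing the series becomes
  multiplication by \<open>1 - y\<close> (\<open>ehrhart_series_shift\<close>). Hence \<open>\<alpha>\<close> is chosen such that
  \<open>R\<^bsub>m,n\<^esub>\<close> minus \<open>\<alpha>\<close> times the image of \<open>R\<^bsub>m-1,n\<^esub>\<close> vanishes at \<open>y = 1\<close>; this is possible because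
  \<open>R\<^bsub>m-1,n\<^esub>(1) > 0\<close>. The quotient by \<open>1 - y\<close> has degree at most \<open>m - 1\<close>, and for \<open>m \<le> n\<close> the
  polynomials \<open>R\<^bsub>m-1-i,n-1+i\<^esub>\<close> have degrees exactly \<open>m-1, \<dots>, 0\<close>, so they form a basis in which
  the quotient expands with coefficients \<open>\<alpha>\<^sub>i\<close> (\<open>gamma_poly_decomposition\<close>).
\<close>

section \<open>Integer vectors with given sum and bounded norm\<close>

text \<open>
  The coefficient of \<open>x\<^bsup>p\<^esup> y\<^bsup>q\<^esup>\<close> in \<open>(1 - xy)\<^bsup>m\<^esup> / ((1 - x)(1 - y))\<^bsup>m+1\<^esup>\<close>. The recursion is multiplication
  by \<open>(1 - xy) / ((1 - x)(1 - y)) = 1 + x/(1 - x) + y/(1 - y)\<close>; combinatorially, the three terms are the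
  possible signs of a new coordinate.
\<close>

primrec slice_count :: "nat \<Rightarrow> nat \<Rightarrow> nat \<Rightarrow> real" where
  "slice_count 0 p q = 1"
| "slice_count (Suc m) p q =
     slice_count m p q + (\<Sum>i<p. slice_count m i q) + (\<Sum>j<q. slice_count m p j)"

definition l1_slice :: "nat \<Rightarrow> nat \<Rightarrow> int \<Rightarrow> int list set" where
  "l1_slice l k d = {xs. length xs = l \<and> sum_list xs = d \<and> sum_list (map abs xs) \<le> int k}"

lemma abs_sum_list_le: "\<bar>sum_list xs\<bar> \<le> sum_list (map abs xs)" for xs :: "int list"
  by (induction xs) auto

lemma even_sum_list_abs: "even (sum_list (map abs xs) - sum_list xs)" for xs :: "int list"
  by (induction xs) auto

lemma finite_l1_slice: "finite (l1_slice l k d)"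
proof (rule finite_subset)
  show "l1_slice l k d \<subseteq> {xs. set xs \<subseteq> {- int k..int k} \<and> length xs = l}"
  proof (clarsimp simp: l1_slice_def)
    fix xs x assume "sum_list (map abs xs) \<le> int k" "x \<in> set xs"
    moreover have "\<bar>x\<bar> \<le> sum_list (map abs xs)"
      using \<open>x \<in> set xs\<close> by (intro member_le_sum_list) auto
    ultimately show "- int k \<le> x \<and> x \<le> int k" by linarith
  qed
qed (rule finite_lists_length_eq, simp)

text \<open>
  Removing a first coordinate \<open>c > 0\<close> lowers both the sum and the norm bound by \<open>c\<close>, that is, it replaces
  \<open>p\<close> by \<open>p - c\<close>; a negative one lowers \<open>q\<close>. Coordinates beyond \<open>p\<close> or \<open>-q\<close> are impossible since the
  remaining entries would have a sum exceeding their norm in absolute value.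
\<close>

lemma card_l1_slice:
  "real (card (l1_slice (Suc m) (p + q) (int p - int q))) = slice_count m p q"
proof (induction m arbitrary: p q)
  case 0
  have "l1_slice (Suc 0) (p + q) (int p - int q) = {[int p - int q]}"
    by (auto simp: l1_slice_def length_Suc_conv)
  then show ?case by simp
next
  case (Suc m)
  let ?A = "(#) 0 ` l1_slice (Suc m) (p + q) (int p - int q)"
  let ?B = "\<lambda>i. (#) (int p - int i) ` l1_slice (Suc m) (i + q) (int i - int q)"
  let ?C = "\<lambda>j. (#) (int j - int q) ` l1_slice (Suc m) (p + j) (int p - int j)"
  have split: "l1_slice (Suc (Suc m)) (p + q) (int p - int q) = ?A \<union> (\<Union>i<p. ?B i) \<union> (\<Union>j<q. ?C j)"
  proof (intro equalityI subsetI)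
    fix xs assume "xs \<in> l1_slice (Suc (Suc m)) (p + q) (int p - int q)"
    then obtain c ys where xs: "xs = c # ys" "length ys = Suc m" "c + sum_list ys = int p - int q"
      "\<bar>c\<bar> + sum_list (map abs ys) \<le> int p + int q"
      by (auto simp: l1_slice_def length_Suc_conv)
    have le: "\<bar>sum_list ys\<bar> \<le> sum_list (map abs ys)" by (rule abs_sum_list_le)
    consider "c = 0" | "c > 0" | "c < 0" by linarith
    then show "xs \<in> ?A \<union> (\<Union>i<p. ?B i) \<union> (\<Union>j<q. ?C j)"
    proof cases
      case 1 then show ?thesis using xs by (auto simp: l1_slice_def)
    next
      case 2
      then have "c \<le> int p" using xs le by linarith
      then have "xs \<in> ?B (nat (int p - c))" "nat (int p - c) < p"
        using xs 2 by (auto simp: l1_slice_def image_iff)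
      then show ?thesis by blast
    next
      case 3
      then have "- c \<le> int q" using xs le by linarith
      then have "xs \<in> ?C (nat (int q + c))" "nat (int q + c) < q"
        using xs 3 by (auto simp: l1_slice_def image_iff)
      then show ?thesis by blast
    qed
  next
    fix xs assume "xs \<in> ?A \<union> (\<Union>i<p. ?B i) \<union> (\<Union>j<q. ?C j)"
    then show "xs \<in> l1_slice (Suc (Suc m)) (p + q) (int p - int q)"
      by (auto simp: l1_slice_def)
  qed
  have finB: "finite (\<Union>i<p. ?B i)" and finC: "finite (\<Union>j<q. ?C j)" and finA: "finite ?A"
    by (simp_all add: finite_l1_slice)
  have cardB: "real (card (\<Union>i<p. ?B i)) = (\<Sum>i<p. slice_count m i q)"
    using Suc.IH by (subst card_UN_disjoint) (auto simp: card_image finite_l1_slice)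
  have cardC: "real (card (\<Union>j<q. ?C j)) = (\<Sum>j<q. slice_count m p j)"
    using Suc.IH by (subst card_UN_disjoint) (auto simp: card_image finite_l1_slice)
  have cardA: "real (card ?A) = slice_count m p q"
    using Suc.IH by (auto simp: card_image)
  have "card (?A \<union> (\<Union>i<p. ?B i) \<union> (\<Union>j<q. ?C j)) = card ?A + card (\<Union>i<p. ?B i) + card (\<Union>j<q. ?C j)"
    using finA finB finC by (subst card_Un_disjoint, force, force, force)+ auto
  then show ?case
    unfolding split using finA finB finC cardA cardB cardC by simp
qed

section \<open>A three-term recurrence for the counts\<close>

text \<open>
  The commutation rule between multiplication by \<open>p\<close> and the prefix sum operator, from which all
  recurrences of the counts are derived.
\<close>

lemma times_partial_sum:
  "real p * (\<Sum>i<p. h i) = (\<Sum>i<p. real i * h i) + (\<Sum>i<p. h i) + (\<Sum>i<p. \<Sum>i'<i. h i')"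
  by (induction p) (auto simp: algebra_simps)

text \<open>
  On generating functions in \<open>x, y\<close> these are the multiplications by \<open>x/(1 - x)\<close> and \<open>y/(1 - y)\<close>. With
  \<open>U, V\<close> for the two operators, the counts are \<open>(1 + U + V)\<^bsup>m\<^esup>\<close> applied to the constant \<open>1\<close>, and everything
  below is computed from the commutation rules \<open>p U = U p + U + U\<^sup>2\<close> and \<open>q V = V q + V + V\<^sup>2\<close>.
\<close>

definition prefix_sum_fst :: "(nat \<Rightarrow> nat \<Rightarrow> real) \<Rightarrow> nat \<Rightarrow> nat \<Rightarrow> real" where
  "prefix_sum_fst f p q = (\<Sum>i<p. f i q)"
definition prefix_sum_snd :: "(nat \<Rightarrow> nat \<Rightarrow> real) \<Rightarrow> nat \<Rightarrow> nat \<Rightarrow> real" where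
  "prefix_sum_snd f p q = (\<Sum>j<q. f p j)"

lemma prefix_sums_commute: "prefix_sum_snd (prefix_sum_fst f) = prefix_sum_fst (prefix_sum_snd f)"
  unfolding prefix_sum_fst_def prefix_sum_snd_def by (intro ext sum.swap)

lemma prefix_sums_linear:
  "prefix_sum_fst (\<lambda>p q. f p q + h p q) p q = prefix_sum_fst f p q + prefix_sum_fst h p q"
  "prefix_sum_fst (\<lambda>p q. f p q - h p q) p q = prefix_sum_fst f p q - prefix_sum_fst h p q"
  "prefix_sum_fst (\<lambda>p q. c * f p q) p q = c * prefix_sum_fst f p q"
  "prefix_sum_snd (\<lambda>p q. f p q + h p q) p q = prefix_sum_snd f p q + prefix_sum_snd h p q"
  "prefix_sum_snd (\<lambda>p q. f p q - h p q) p q = prefix_sum_snd f p q - prefix_sum_snd h p q"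
  "prefix_sum_snd (\<lambda>p q. c * f p q) p q = c * prefix_sum_snd f p q"
  unfolding prefix_sum_fst_def prefix_sum_snd_def
  by (simp_all add: sum.distrib sum_subtractf sum_distrib_left)

lemma coord_times_prefix_sum_fst: 
  "real p * prefix_sum_fst f p q = prefix_sum_fst (\<lambda>p q. real p * f p q) p q + prefix_sum_fst f p q + prefix_sum_fst (prefix_sum_fst f) p q"
  "real q * prefix_sum_fst f p q = prefix_sum_fst (\<lambda>p q. real q * f p q) p q"
  unfolding prefix_sum_fst_def by (rule times_partial_sum) (simp add: sum_distrib_left)
lemma coord_times_prefix_sum_snd: 
  "real q * prefix_sum_snd f p q = prefix_sum_snd (\<lambda>p q. real q * f p q) p q + prefix_sum_snd f p q + prefix_sum_snd (prefix_sum_snd f) p q"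
  "real p * prefix_sum_snd f p q = prefix_sum_snd (\<lambda>p q. real p * f p q) p q"
  unfolding prefix_sum_snd_def by (rule times_partial_sum) (simp add: sum_distrib_left)

lemma slice_count_Suc:
  "slice_count (Suc m) = (\<lambda>p q. slice_count m p q + prefix_sum_fst (slice_count m) p q + prefix_sum_snd (slice_count m) p q)"
  by (intro ext) (simp add: prefix_sum_fst_def prefix_sum_snd_def)

lemma diff_times_prefix_sum:
  "(real p - real q) * prefix_sum_fst f p q
     = prefix_sum_fst (\<lambda>p q. (real p - real q) * f p q) p q + prefix_sum_fst f p q + prefix_sum_fst (prefix_sum_fst f) p q"
  "(real p - real q) * prefix_sum_snd f p q
     = prefix_sum_snd (\<lambda>p q. (real p - real q) * f p q) p q - prefix_sum_snd f p q - prefix_sum_snd (prefix_sum_snd f) p q"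
  unfolding left_diff_distrib coord_times_prefix_sum_fst coord_times_prefix_sum_snd prefix_sums_linear by simp_all

lemma add_times_prefix_sum:
  "(real p + real q) * prefix_sum_fst f p q
     = prefix_sum_fst (\<lambda>p q. (real p + real q) * f p q) p q + prefix_sum_fst f p q + prefix_sum_fst (prefix_sum_fst f) p q"
  "(real p + real q) * prefix_sum_snd f p q
     = prefix_sum_snd (\<lambda>p q. (real p + real q) * f p q) p q + prefix_sum_snd f p q + prefix_sum_snd (prefix_sum_snd f) p q"
  unfolding distrib_right coord_times_prefix_sum_fst coord_times_prefix_sum_snd prefix_sums_linear by simp_all

text \<open>
  With \<open>S = 1 + U + V\<close>, the rules give \<open>(p - q) S = S (p - q) + (U - V) S\<close>, so that each application of
  \<open>S\<close> raises the factor in front of \<open>U - V\<close> by one.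
\<close>

lemma diff_times_step:
  assumes f: "\<And>p q. (real p - real q) * f p q = c * (prefix_sum_fst f p q - prefix_sum_snd f p q)"
    and g: "g = (\<lambda>p q. f p q + prefix_sum_fst f p q + prefix_sum_snd f p q)"
  shows "(real p - real q) * g p q = (c + 1) * (prefix_sum_fst g p q - prefix_sum_snd g p q)"
  unfolding g distrib_left diff_times_prefix_sum f prefix_sums_linear prefix_sums_commute
  by (simp add: algebra_simps)

lemma diff_times_slice_count:
  "(real p - real q) * slice_count m p q
     = (real m + 1) * (prefix_sum_fst (slice_count m) p q - prefix_sum_snd (slice_count m) p q)"
proof (induction m arbitrary: p q)
  case 0
  show ?case by (simp add: prefix_sum_fst_def prefix_sum_snd_def)
next
  case (Suc m)
  have "real (Suc m) + 1 = (real m + 1) + 1" by simp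
  then show ?case using diff_times_step[OF Suc slice_count_Suc] by (simp only:)
qed

text \<open>
  With \<open>S = 1 + U + V\<close>, the rules give \<open>(p + q) S = S (p + q) + S (S - 1) - 2 U V\<close>. The correction term \<open>U V\<close>
  is the reason for carrying along the predecessor \<open>e\<close> of \<open>f\<close>.
\<close>

lemma add_times_step:
  assumes f: "\<And>p q. (real p + real q) * f p q
      = (c + 1) * (prefix_sum_fst f p q + prefix_sum_snd f p q) - 2 * c * prefix_sum_fst (prefix_sum_snd e) p q"
    and f': "f = (\<lambda>p q. e p q + prefix_sum_fst e p q + prefix_sum_snd e p q)"
    and g: "g = (\<lambda>p q. f p q + prefix_sum_fst f p q + prefix_sum_snd f p q)"
  shows "(real p + real q) * g p q
      = (c + 2) * (prefix_sum_fst g p q + prefix_sum_snd g p q) - 2 * (c + 1) * prefix_sum_fst (prefix_sum_snd f) p q"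
proof -
  have s2: "prefix_sum_snd f = (\<lambda>p q. prefix_sum_snd e p q + prefix_sum_fst (prefix_sum_snd e) p q + prefix_sum_snd (prefix_sum_snd e) p q)"
    unfolding f' by (intro ext) (simp add: prefix_sums_linear prefix_sums_commute)
  have e: "prefix_sum_fst (prefix_sum_snd f) p q = prefix_sum_fst (prefix_sum_snd e) p q + prefix_sum_fst (prefix_sum_fst (prefix_sum_snd e)) p q + prefix_sum_fst (prefix_sum_snd (prefix_sum_snd e)) p q"
    unfolding s2 prefix_sums_linear ..
  show ?thesis
    unfolding g distrib_left add_times_prefix_sum f prefix_sums_linear prefix_sums_commute
    by (simp add: e algebra_simps)
qed

lemma add_times_slice_count:
  "(real p + real q) * slice_count (Suc m) p q
     = (real m + 2) * (prefix_sum_fst (slice_count (Suc m)) p q + prefix_sum_snd (slice_count (Suc m)) p q)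
               - 2 * (real m + 1) * prefix_sum_fst (prefix_sum_snd (slice_count m)) p q"
proof (induction m arbitrary: p q)
  case 0
  have *: "slice_count 0 = (\<lambda>p q. 1)" by (intro ext) simp
  show ?case
    unfolding slice_count_Suc * distrib_left add_times_prefix_sum prefix_sums_linear prefix_sums_commute
    by (simp add: prefix_sum_fst_def prefix_sum_snd_def sum.distrib algebra_simps)
next
  case (Suc m)
  have IH: "(real p + real q) * slice_count (Suc m) p q
     = ((real m + 1) + 1) * (prefix_sum_fst (slice_count (Suc m)) p q + prefix_sum_snd (slice_count (Suc m)) p q)
               - 2 * (real m + 1) * prefix_sum_fst (prefix_sum_snd (slice_count m)) p q" for p q
    unfolding Suc by simp
  have "real (Suc m) + 2 = (real m + 1) + 2" "real (Suc m) + 1 = (real m + 1) + 1" by simp_all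
  then show ?case using add_times_step[OF IH slice_count_Suc slice_count_Suc] by (simp only:)
qed

text \<open>
  Applying \<open>p - q\<close> twice to the count for \<open>m\<close> and \<open>p + q\<close> once to the count for \<open>m + 1\<close> expresses both in
  \<open>U\<close> and \<open>V\<close>; the terms with \<open>U V\<close> cancel in exactly this combination. What matters later is that the
  coefficient \<open>p - q\<close> occurs only squared and only next to the count for \<open>m\<close>.
\<close>

lemma slice_count_recurrence:
  "(real m + 2)\<^sup>2 * slice_count (Suc (Suc m)) p q
     = (2 * real m + 3) * (real p + real q + 1) * slice_count (Suc m) p q
       + ((real m + 1)\<^sup>2 - (real p - real q)\<^sup>2) * slice_count m p q"
proof -
  define f where "f = slice_count m"
  define g where "g = slice_count (Suc m)"
  have g: "g = (\<lambda>p q. f p q + prefix_sum_fst f p q + prefix_sum_snd f p q)"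
    unfolding f_def g_def by (rule slice_count_Suc)
  have d: "(real p - real q) * f p q = (real m + 1) * (prefix_sum_fst f p q - prefix_sum_snd f p q)" for p q
    unfolding f_def by (rule diff_times_slice_count)
  have 1: "(real p - real q)\<^sup>2 * f p q
      = (real m + 1) * ((real p - real q) * prefix_sum_fst f p q - (real p - real q) * prefix_sum_snd f p q)"
    unfolding power2_eq_square mult.assoc d by (simp add: algebra_simps)
  have 2: "(real p + real q) * g p q
      = (real m + 2) * (prefix_sum_fst g p q + prefix_sum_snd g p q) - 2 * (real m + 1) * prefix_sum_fst (prefix_sum_snd f) p q"
    unfolding f_def g_def by (rule add_times_slice_count)
  have "(real m + 2)\<^sup>2 * (g p q + prefix_sum_fst g p q + prefix_sum_snd g p q)
     = (2 * real m + 3) * ((real p + real q) * g p q + g p q)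
       + (real m + 1)\<^sup>2 * f p q - (real p - real q)\<^sup>2 * f p q"
    unfolding 1 2 diff_times_prefix_sum d unfolding g prefix_sums_linear prefix_sums_commute
    by (simp add: power2_eq_square algebra_simps)
  then show ?thesis
    unfolding slice_count_Suc[of "Suc m"] f_def[symmetric] g_def[symmetric]
    by (simp add: algebra_simps)
qed

section \<open>Power series in the gamma variable\<close>

definition gamma_var :: "real fps" where
  "gamma_var = 4 * fps_X * (inverse (1 + fps_X))\<^sup>2"

text \<open>
  Palindromic numerators of degree \<open>N\<close> over \<open>(1 - t)\<^bsup>N+2\<^esup>\<close> in their \<open>\<gamma>\<close>-expansion: the monomial \<open>y\<^sup>i\<close> stands for
  \<open>(4t)\<^sup>i (1 + t)\<^bsup>N-2i\<^esup>\<close>. Composing with the power series \<open>4t/(1+t)\<^sup>2\<close> keeps the identities below valid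
  for all polynomials, whatever their degree.
\<close>

definition gamma_series :: "nat \<Rightarrow> real poly \<Rightarrow> real fps" where
  "gamma_series N p =
     (1 + fps_X) ^ N * inverse (1 - fps_X) ^ (N + 2) * (fps_of_poly p oo gamma_var)"

text \<open>
  The action on \<open>p\<close> of the map \<open>F \<mapsto> (t F)'\<close>, which multiplies the \<open>k\<close>-th coefficient by \<open>k + 1\<close>.
\<close>

definition gamma_op :: "nat \<Rightarrow> real poly \<Rightarrow> real poly" where
  "gamma_op N p = [:1, real N / 2:] * p + [:0, 1, -1:] * pderiv p"

lemma one_plus_X: "(1 + fps_X :: real fps) * inverse (1 + fps_X) = 1"
  by (rule inverse_mult_eq_1') simp
lemma one_minus_X: "(1 - fps_X :: real fps) * inverse (1 - fps_X) = 1"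
  by (rule inverse_mult_eq_1') simp

lemma gamma_var_0 [simp]: "fps_nth gamma_var 0 = 0"
  by (simp add: gamma_var_def)

lemma compose_gamma:
  "fps_of_poly (p + q) oo gamma_var = (fps_of_poly p oo gamma_var) + (fps_of_poly q oo gamma_var)"
  "fps_of_poly (p - q) oo gamma_var = (fps_of_poly p oo gamma_var) - (fps_of_poly q oo gamma_var)"
  "fps_of_poly (p * q) oo gamma_var = (fps_of_poly p oo gamma_var) * (fps_of_poly q oo gamma_var)"
  "fps_of_poly (smult c p) oo gamma_var = fps_const c * (fps_of_poly p oo gamma_var)"
  "fps_of_poly [:a, b:] oo gamma_var = fps_const a + fps_const b * gamma_var"
  "fps_of_poly 1 oo gamma_var = 1"
  by (simp_all add: fps_of_poly_simps fps_compose_add_distrib fps_compose_sub_distrib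
      fps_compose_mult_distrib fps_of_poly_smult fps_const_compose fps_of_poly_pCons mult.commute)

lemma fps_const_minus_one: "fps_const (- 1) = (- 1 :: real fps)"
  by (simp flip: fps_const_neg)

lemma gamma_series_linear:
  "gamma_series N (p + q) = gamma_series N p + gamma_series N q"
  "gamma_series N (p - q) = gamma_series N p - gamma_series N q"
  "gamma_series N (smult c p) = fps_const c * gamma_series N p"
  unfolding gamma_series_def compose_gamma by (simp_all add: algebra_simps)

text \<open>
  The identity behind this is \<open>1 - 4t/(1+t)\<^sup>2 = ((1-t)/(1+t))\<^sup>2\<close>.
\<close>

lemma gamma_series_shift:
  "gamma_series (N + 2) ([:1, -1:] * p) = gamma_series N p"
proof -
  define A B a b P where "A = (1 + fps_X :: real fps)" "B = (1 - fps_X :: real fps)"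
    "a = inverse A" "b = inverse B" "P = fps_of_poly p oo gamma_var"
  note defs = this
  have r: "A * a = 1" "B * b = 1" "A = 1 + fps_X" "B = 1 - fps_X"
    using one_plus_X one_minus_X by (simp_all add: defs)
  have "A\<^sup>2 * b\<^sup>2 * (1 - 4 * fps_X * a\<^sup>2) = 1"
    using r by algebra
  then have "A ^ N * b ^ (N + 2) * P = A ^ N * b ^ (N + 2) * P * (A\<^sup>2 * b\<^sup>2 * (1 - 4 * fps_X * a\<^sup>2))"
    by simp
  also have "\<dots> = A ^ (N + 2) * b ^ (N + 2 + 2) * ((1 - 4 * fps_X * a\<^sup>2) * P)"
    by (simp add: power_add algebra_simps power2_eq_square)
  also have "(1 - 4 * fps_X * a\<^sup>2) * P = fps_of_poly ([:1, -1:] * p) oo gamma_var"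
    unfolding compose_gamma fps_const_minus_one by (simp add: defs gamma_var_def)
  finally show ?thesis
    unfolding gamma_series_def by (simp add: defs)
qed

lemma deriv_power_one_plus_X:
  "fps_deriv ((1 + fps_X :: real fps) ^ N) = of_nat N * inverse (1 + fps_X) * (1 + fps_X) ^ N"
proof (induction N)
  case (Suc N)
  let ?A = "1 + fps_X :: real fps"
  have "fps_deriv (?A ^ Suc N) = ?A * inverse ?A * of_nat N * ?A ^ N + ?A ^ N"
    unfolding power_Suc fps_deriv_mult Suc by simp
  also have "\<dots> = of_nat (Suc N) * (?A * inverse ?A) * ?A ^ N"
    by (simp only: one_plus_X) (simp add: algebra_simps)
  finally show ?case by (simp add: mult_ac)
qed simp

lemma deriv_power_inverse_one_minus_X:
  "fps_deriv (inverse (1 - fps_X :: real fps) ^ N) = of_nat N * inverse (1 - fps_X) ^ (N + 1)"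
proof (induction N)
  case (Suc N)
  have "fps_deriv (inverse (1 - fps_X :: real fps)) = (inverse (1 - fps_X))\<^sup>2"
    by (subst fps_inverse_deriv) simp_all
  with Suc show ?case
    unfolding power_Suc fps_deriv_mult by (simp add: algebra_simps power2_eq_square)
qed simp

lemma deriv_gamma_var:
  "fps_deriv gamma_var = 4 * inverse (1 + fps_X)^2 - 8 * fps_X * inverse (1 + fps_X)^3"
  unfolding gamma_var_def
  by (simp add: fps_deriv_power' fps_inverse_deriv power2_eq_square power3_eq_cube algebra_simps)

text \<open>
  By the product and chain rules, after cancelling the common powers of \<open>1 + t\<close> and \<open>1/(1 - t)\<close>, this is an
  identity between rational functions that follows from the defining equations of the two inverses.
\<close>

lemma gamma_series_deriv:
  "fps_deriv (fps_X * gamma_series N p) = gamma_series (N + 1) (gamma_op N p)"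
proof -
  define A B a b P D n where "A = (1 + fps_X :: real fps)" "B = (1 - fps_X :: real fps)"
    "a = inverse A" "b = inverse B" "P = fps_of_poly p oo gamma_var"
    "D = fps_of_poly (pderiv p) oo gamma_var" "n = (of_nat N :: real fps)"
  note defs = this
  have r: "A * a = 1" "B * b = 1" "A = 1 + fps_X" "B = 1 - fps_X"
    using one_plus_X one_minus_X by (simp_all add: defs)
  have key: "P + fps_X * (n * a * P + (n + 2) * b * P + D * (4 * a\<^sup>2 - 8 * fps_X * a ^ 3))
      = A * b * ((1 + 2 * n * fps_X * a\<^sup>2) * P
          + (4 * fps_X * a\<^sup>2) * (1 - 4 * fps_X * a\<^sup>2) * D)"
    using r by algebra
  have dP: "fps_deriv P = D * (4 * a\<^sup>2 - 8 * fps_X * a ^ 3)"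
    unfolding defs by (simp add: fps_compose_deriv fps_of_poly_pderiv deriv_gamma_var)
  have dF: "fps_deriv (gamma_series N p) = A ^ N * b ^ (N + 2) *
      (n * a * P + (n + 2) * b * P + fps_deriv P)"
    unfolding gamma_series_def fps_deriv_mult deriv_power_one_plus_X deriv_power_inverse_one_minus_X
    unfolding defs by (simp add: algebra_simps)
  have c: "fps_of_poly (gamma_op N p) oo gamma_var
      = (1 + 2 * n * fps_X * a\<^sup>2) * P + (4 * fps_X * a\<^sup>2) * (1 - 4 * fps_X * a\<^sup>2) * D"
  proof -
    have "[:0, 1, -1:] = [:0, 1:] * ([:1, -1:] :: real poly)" by simp
    moreover have "fps_const (real N / 2) * 4 = 2 * n"
      by (simp add: defs fps_of_nat[symmetric] numeral_fps_const)
    then have "fps_const (real N / 2) * (4 * fps_X * (inverse (1 + fps_X))\<^sup>2)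
        = 2 * of_nat N * fps_X * (inverse (1 + fps_X))\<^sup>2"
      by (simp add: mult.assoc[symmetric] defs)
    ultimately show ?thesis
      unfolding gamma_op_def compose_gamma
      by (simp only: compose_gamma fps_const_minus_one) (simp add: gamma_var_def defs)
  qed
  have "fps_deriv (fps_X * gamma_series N p) = A ^ N * b ^ (N + 2) *
    (P + fps_X * (n * a * P + (n + 2) * b * P + D * (4 * a\<^sup>2 - 8 * fps_X * a ^ 3)))"
    unfolding fps_deriv_mult dF dP by (simp add: gamma_series_def defs algebra_simps)
  also have "\<dots> = A ^ (N + 1) * b ^ (N + 1 + 2) * ((1 + 2 * n * fps_X * a\<^sup>2) * P
          + (4 * fps_X * a\<^sup>2) * (1 - 4 * fps_X * a\<^sup>2) * D)"
    unfolding key by (simp add: algebra_simps)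
  also have "\<dots> = gamma_series (N + 1) (gamma_op N p)"
    unfolding gamma_series_def c by (simp add: defs)
  finally show ?thesis .
qed

section \<open>The gamma polynomials and their recurrence\<close>

definition gamma_poly :: "nat \<Rightarrow> nat \<Rightarrow> real poly" where
  "gamma_poly m n =
     (\<Sum>i\<le>m. monom (real ((2 * i choose i) * (m choose i) * (n choose i)) / 4 ^ i) i)"

lemma coeff_gamma_poly:
  "coeff (gamma_poly m n) i = real ((2 * i choose i) * (m choose i) * (n choose i)) / 4 ^ i"
  by (simp add: gamma_poly_def coeff_sum)

lemma coeff_gamma_op:
  "coeff (gamma_op N p) 0 = coeff p 0"
  "coeff (gamma_op N p) (Suc i)
     = (real i + 2) * coeff p (Suc i) + (real N / 2 - real i) * coeff p i"
  by (simp_all add: gamma_op_def coeff_pderiv algebra_simps coeff_pCons split: nat.split)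

lemma binomial_step: "(real j + 1) * real (m choose Suc j) = (real m - real j) * real (m choose j)"
  using gbinomial_mult_1[of "real m" j] by (simp add: binomial_gbinomial algebra_simps)

lemma central_binomial_step:
  "(real j + 1) * real (2 * Suc j choose Suc j) = 2 * (2 * real j + 1) * real (2 * j choose j)"
proof -
  have 1: "real (Suc j) * real (Suc (2*j) choose Suc j) = real (Suc (2*j)) * real (2*j choose j)"
    using Suc_times_binomial_eq[of "2*j" j]
    by (simp only: of_nat_mult[symmetric] mult.commute)
  have "2 * Suc j choose Suc j = (Suc (2*j) choose Suc j) + (Suc (2*j) choose j)"
    by simp
  also have "\<dots> = 2 * (Suc (2*j) choose Suc j)"
    using binomial_symmetric[of j "Suc (2*j)"] by (simp del: binomial_Suc_Suc)
  finally have 2: "real (2 * Suc j choose Suc j) = 2 * real (Suc (2*j) choose Suc j)"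
    by (simp del: binomial_Suc_Suc)
  show ?thesis using 1 unfolding 2 by (simp add: algebra_simps del: binomial_Suc_Suc)
qed

text \<open>
  The recurrence below, for the coefficient of \<open>y\<^bsup>J+2\<^esup>\<close>. Here \<open>e, a, b\<close> stand for the binomial coefficients of
  \<open>m\<close> over \<open>J, J+1, J+2\<close>, primed letters for those of \<open>n\<close>, and \<open>w, W\<close> for the central binomial
  coefficients. Their quotients are rational functions, and pulling out the common factors \<open>x, x', y\<close> clears
  all denominators, which turns the claim into a polynomial identity.
\<close>

lemma gamma_coefficient_identity:
  fixes J M N m n x x' y :: real
  assumes "m = J + M" "n = J + N"
    and "e = (J + 1) * (J + 2) * x" "a = M * (J + 2) * x" "b = M * (M - 1) * x"
    and "e' = (J + 1) * (J + 2) * x'" "a' = N * (J + 2) * x'" "b' = N * (N - 1) * x'"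
    and "w = (J + 2) * y" "W = 2 * (2 * J + 3) * y"
  shows "(m + 2)\<^sup>2 * (W * (b + 2 * a + e) * b')
      = (2 * m + 3) * ((J + 3) * (W * (b + a) * b')
            + 2 * (m + n - 2 * J - 1) * (w * (a + e) * a'))
      + ((m + 1)\<^sup>2 - (n + 1)\<^sup>2) * (W * b * b' - 4 * (w * a * a'))
      + (n + 2)\<^sup>2 * (W * b * (b' + 2 * a' + e'))
      - (2 * n + 3) * ((J + 3) * (W * b * (b' + a'))
            + 2 * (m + n - 2 * J - 1) * (w * a * (a' + e')))"
  unfolding assms by (simp add: power2_eq_square) algebra

text \<open>
  This is the relation that the products of counts inherit from \<open>slice_count_recurrence\<close>, written on the
  \<open>\<gamma>\<close>-side. The first two coefficients are separate cases because the general argument uses binomial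
  coefficients of lower index \<open>i - 2\<close>.
\<close>

lemma gamma_poly_recurrence:
  "smult ((real m + 2)\<^sup>2) (gamma_poly (Suc (Suc m)) n)
     = smult (2 * real m + 3) (gamma_op (m + n + 1) (gamma_poly (Suc m) n))
     + smult ((real m + 1)\<^sup>2 - (real n + 1)\<^sup>2) ([:1, -1:] * gamma_poly m n)
     + smult ((real n + 2)\<^sup>2) (gamma_poly m (Suc (Suc n)))
     - smult (2 * real n + 3) (gamma_op (m + n + 1) (gamma_poly m (Suc n)))"
proof (rule poly_eqI)
  fix i
  consider "i = 0" | "i = 1" | j where "i = Suc (Suc j)"
    by (metis One_nat_def not0_implies_Suc)
  then show "coeff (smult ((real m + 2)\<^sup>2) (gamma_poly (Suc (Suc m)) n)) i = coeff
      (smult (2 * real m + 3) (gamma_op (m + n + 1) (gamma_poly (Suc m) n))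
     + smult ((real m + 1)\<^sup>2 - (real n + 1)\<^sup>2) ([:1, -1:] * gamma_poly m n)
     + smult ((real n + 2)\<^sup>2) (gamma_poly m (Suc (Suc n)))
     - smult (2 * real n + 3) (gamma_op (m + n + 1) (gamma_poly m (Suc n)))) i"
  proof cases
    case 1
    then show ?thesis
      by (simp add: coeff_gamma_op coeff_gamma_poly) (simp add: power2_eq_square algebra_simps)
  next
    case 2
    then show ?thesis
      by (simp add: coeff_gamma_op coeff_gamma_poly) (simp add: power2_eq_square field_simps)
  next
    case (3 j)
    define e a b e' a' b' w W where "e = real (m choose j)" "a = real (m choose Suc j)"
      "b = real (m choose Suc (Suc j))" "e' = real (n choose j)" "a' = real (n choose Suc j)"
      "b' = real (n choose Suc (Suc j))" "w = real (2 * Suc j choose Suc j)"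
      "W = real (2 * Suc (Suc j) choose Suc (Suc j))"
    note defs = this
    have pos: "real j + 1 \<noteq> 0" "real j + 2 \<noteq> 0" by linarith+
    \<comment> \<open>The divisions are harmless: the factors \<open>j + 1\<close> and \<open>j + 2\<close> never vanish, even when \<open>m < j\<close>.\<close>
    define M N x x' y where "M = real m - real j" "N = real n - real j"
      "x = e / ((real j + 1) * (real j + 2))" "x' = e' / ((real j + 1) * (real j + 2))"
      "y = w / (real j + 2)"
    note defs' = this
    have e: "e = (real j + 1) * (real j + 2) * x" "e' = (real j + 1) * (real j + 2) * x'"
      "w = (real j + 2) * y"
      using pos by (simp_all add: defs')
    have "(real j + 1) * a = M * e" "(real j + 1) * a' = N * e'"
      using binomial_step[of j m] binomial_step[of j n] by (simp_all only: defs defs')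
    then have "(real j + 1) * (a - M * (real j + 2) * x) = 0"
      "(real j + 1) * (a' - N * (real j + 2) * x') = 0"
      unfolding e by (simp_all add: algebra_simps)
    then have a: "a = M * (real j + 2) * x" "a' = N * (real j + 2) * x'"
      using pos by simp_all
    have "(real j + 2) * b = (M - 1) * a" "(real j + 2) * b' = (N - 1) * a'"
      using binomial_step[of "Suc j" m] binomial_step[of "Suc j" n]
      by (simp_all add: defs defs' algebra_simps)
    then have "(real j + 2) * (b - M * (M - 1) * x) = 0" "(real j + 2) * (b' - N * (N - 1) * x') = 0"
      unfolding a by (simp_all add: algebra_simps)
    then have b: "b = M * (M - 1) * x" "b' = N * (N - 1) * x'"
      using pos by simp_all
    have "(real j + 2) * W = 2 * (2 * real j + 3) * w"
      using central_binomial_step[of "Suc j"] unfolding defs by (simp add: algebra_simps del: binomial_Suc_Suc)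
    then have "(real j + 2) * (W - 2 * (2 * real j + 3) * y) = 0"
      unfolding e by (simp add: algebra_simps)
    then have W: "W = 2 * (2 * real j + 3) * y"
      using pos by simp
    have choose:
      "real (Suc (Suc m) choose Suc (Suc j)) = b + 2 * a + e"
      "real (Suc m choose Suc (Suc j)) = b + a" "real (Suc m choose Suc j) = a + e"
      "real (Suc (Suc n) choose Suc (Suc j)) = b' + 2 * a' + e'"
      "real (Suc n choose Suc (Suc j)) = b' + a'" "real (Suc n choose Suc j) = a' + e'"
      by (simp_all add: defs)
    define h where "h = (real m + real n - 2 * real j - 1) / 2"
    define u :: real where "u = 1 / (16 * 4 ^ j)"
    have coeffs:
      "coeff (gamma_poly k l) (Suc (Suc j)) = W * real (k choose Suc (Suc j)) * real (l choose Suc (Suc j)) * u"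
      "coeff (gamma_poly k l) (Suc j) = 4 * (w * real (k choose Suc j) * real (l choose Suc j)) * u"
      for k l
      by (simp_all add: coeff_gamma_poly defs u_def del: binomial_Suc_Suc)
    have scaled: "(real m + 2)\<^sup>2 * (W * (b + 2 * a + e) * b') * u
      = ((2 * real m + 3) * ((real j + 3) * (W * (b + a) * b')
            + 2 * (real m + real n - 2 * real j - 1) * (w * (a + e) * a'))
      + ((real m + 1)\<^sup>2 - (real n + 1)\<^sup>2) * (W * b * b' - 4 * (w * a * a'))
      + (real n + 2)\<^sup>2 * (W * b * (b' + 2 * a' + e'))
      - (2 * real n + 3) * ((real j + 3) * (W * b * (b' + a'))
            + 2 * (real m + real n - 2 * real j - 1) * (w * a * (a' + e')))) * u"
      by (rule arg_cong[where f = "\<lambda>z. z * u"],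
          rule gamma_coefficient_identity[OF _ _ e(1) a(1) b(1) e(2) a(2) b(2) e(3) W])
         (simp_all add: defs'(1,2))
    have h4: "2 * (real m + real n - 2 * real j - 1) = 4 * h"
      by (simp add: h_def)
    with scaled have key: "(real m + 2)\<^sup>2 * (W * (b + 2 * a + e) * b') * u
      = ((2 * real m + 3) * ((real j + 3) * (W * (b + a) * b') + 4 * h * (w * (a + e) * a'))
      + ((real m + 1)\<^sup>2 - (real n + 1)\<^sup>2) * (W * b * b' - 4 * (w * a * a'))
      + (real n + 2)\<^sup>2 * (W * b * (b' + 2 * a' + e'))
      - (2 * real n + 3) * ((real j + 3) * (W * b * (b' + a')) + 4 * h * (w * a * (a' + e')))) * u"
      by (simp only: h4)
    have h: "real (m + n + 1) / 2 - real (Suc j) = h"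
      by (simp add: h_def field_simps)
    show ?thesis
      unfolding 3
      by (simp only: coeff_add coeff_diff coeff_smult coeff_gamma_op coeffs choose h,
          simp only: mult_pCons_left coeff_add coeff_smult coeff_pCons_Suc mult_zero_left,
          simp only: coeff_0 add_0_right coeffs defs(1-6)[symmetric] of_nat_Suc mult_1 mult_1_right,
          use key in \<open>simp add: algebra_simps del: mult_cancel_right mult_cancel_left\<close>)
  qed
qed

section \<open>Pairs of vectors with equal sum\<close>

text \<open>
  The \<open>k\<close>-th coefficient counts the pairs of vectors of equal sum and norm at most \<open>k\<close> whose sum is
  congruent to \<open>k\<close> modulo 2. Norm and sum of an integer vector have the same parity, so the remaining pairs
  have norms at most \<open>k - 1\<close> and are counted by the coefficient before.
\<close>

definition parity_series :: "nat \<Rightarrow> nat \<Rightarrow> real fps" where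
  "parity_series m n = Abs_fps (\<lambda>k. \<Sum>p\<le>k. slice_count m p (k - p) * slice_count n p (k - p))"

lemma fps_nth_deriv_X_mult: "fps_nth (fps_deriv (fps_X * F)) k = (real k + 1) * fps_nth F k"
  for F :: "real fps"
  by (simp add: fps_deriv_nth del: fps_deriv_mult)

text \<open>
  Both recurrences, for the counts of length \<open>m\<close> and of length \<open>n\<close>, express \<open>(p - q)\<^sup>2\<close> times the same product;
  subtracting them removes that factor and leaves coefficients depending on \<open>k = p + q\<close> only.
\<close>

lemma parity_series_recurrence:
  "fps_const ((real m + 2)\<^sup>2) * parity_series (Suc (Suc m)) n
     = fps_const (2 * real m + 3) * fps_deriv (fps_X * parity_series (Suc m) n)
     + fps_const ((real m + 1)\<^sup>2 - (real n + 1)\<^sup>2) * parity_series m n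
     + fps_const ((real n + 2)\<^sup>2) * parity_series m (Suc (Suc n))
     - fps_const (2 * real n + 3) * fps_deriv (fps_X * parity_series m (Suc n))"
proof (rule fps_ext)
  fix k
  let ?g = "\<lambda>m p. slice_count m p (k - p)"
  have rec: "(real m + 2)\<^sup>2 * (?g (Suc (Suc m)) p * ?g n p)
     = (2 * real m + 3) * (real k + 1) * (?g (Suc m) p * ?g n p)
     + ((real m + 1)\<^sup>2 - (real n + 1)\<^sup>2) * (?g m p * ?g n p)
     + (real n + 2)\<^sup>2 * (?g m p * ?g (Suc (Suc n)) p)
     - (2 * real n + 3) * (real k + 1) * (?g m p * ?g (Suc n) p)" if "p \<le> k" for p
  proof -
    define d where "d = real p - real (k - p)"
    have k: "real p + real (k - p) + 1 = real k + 1" using that by simp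
    have A: "(real m + 2)\<^sup>2 * ?g (Suc (Suc m)) p
      = (2 * real m + 3) * (real k + 1) * ?g (Suc m) p + ((real m + 1)\<^sup>2 - d\<^sup>2) * ?g m p"
      unfolding slice_count_recurrence k d_def ..
    have B: "(real n + 2)\<^sup>2 * ?g (Suc (Suc n)) p
      = (2 * real n + 3) * (real k + 1) * ?g (Suc n) p + ((real n + 1)\<^sup>2 - d\<^sup>2) * ?g n p"
      unfolding slice_count_recurrence k d_def ..
    have "(real m + 2)\<^sup>2 * ?g (Suc (Suc m)) p * ?g n p - ?g m p * ((real n + 2)\<^sup>2 * ?g (Suc (Suc n)) p)
      = (2 * real m + 3) * (real k + 1) * (?g (Suc m) p * ?g n p)
     + ((real m + 1)\<^sup>2 - (real n + 1)\<^sup>2) * (?g m p * ?g n p)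
     - (2 * real n + 3) * (real k + 1) * (?g m p * ?g (Suc n) p)"
      unfolding A B by (simp del: slice_count.simps add: algebra_simps)
    then show ?thesis by (simp del: slice_count.simps add: algebra_simps)
  qed
  have "(\<Sum>p\<le>k. (real m + 2)\<^sup>2 * (?g (Suc (Suc m)) p * ?g n p))
     = (\<Sum>p\<le>k. (2 * real m + 3) * (real k + 1) * (?g (Suc m) p * ?g n p)
     + ((real m + 1)\<^sup>2 - (real n + 1)\<^sup>2) * (?g m p * ?g n p)
     + (real n + 2)\<^sup>2 * (?g m p * ?g (Suc (Suc n)) p)
     - (2 * real n + 3) * (real k + 1) * (?g m p * ?g (Suc n) p))"
    by (rule sum.cong) (simp_all only: atMost_iff rec)
  then show "fps_nth (fps_const ((real m + 2)\<^sup>2) * parity_series (Suc (Suc m)) n) k =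
     fps_nth (fps_const (2 * real m + 3) * fps_deriv (fps_X * parity_series (Suc m) n)
     + fps_const ((real m + 1)\<^sup>2 - (real n + 1)\<^sup>2) * parity_series m n
     + fps_const ((real n + 2)\<^sup>2) * parity_series m (Suc (Suc n))
     - fps_const (2 * real n + 3) * fps_deriv (fps_X * parity_series m (Suc n))) k"
    by (simp del: slice_count.simps fps_deriv_mult add: fps_nth_deriv_X_mult parity_series_def sum.distrib sum_subtractf
        sum_distrib_left[symmetric] mult.assoc add.commute)
qed

lemma sum_antidiagonal_prefix_sum_fst:
  "(\<Sum>p\<le>k. prefix_sum_fst f p (k - p)) = (\<Sum>l<k. \<Sum>p\<le>l. f p (l - p))"
proof -
  have "(\<Sum>p\<le>k. prefix_sum_fst f p (k - p)) = (\<Sum>(p, i)\<in>(SIGMA p:{..k}. {..<p}). f i (k - p))"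
    unfolding prefix_sum_fst_def by (simp add: sum.Sigma)
  also have "\<dots> = (\<Sum>(l, p)\<in>(SIGMA l:{..<k}. {..l}). f p (l - p))"
    \<comment> \<open>The point \<open>(i, k - p)\<close> lies on the antidiagonal of \<open>k - p + i\<close>.\<close>
    by (rule sum.reindex_bij_witness[where j = "\<lambda>(p, i). (k - p + i, i)" and i = "\<lambda>(l, i). (k - l + i, i)"])
       auto
  also have "\<dots> = (\<Sum>l<k. \<Sum>p\<le>l. f p (l - p))"
    by (simp add: sum.Sigma)
  finally show ?thesis .
qed

lemma sum_antidiagonal_prefix_sum_snd:
  "(\<Sum>p\<le>k. prefix_sum_snd f p (k - p)) = (\<Sum>l<k. \<Sum>p\<le>l. f p (l - p))"
proof -
  have "(\<Sum>p\<le>k. prefix_sum_snd f p (k - p)) = (\<Sum>(p, i)\<in>(SIGMA p:{..k}. {..<k-p}). f p i)"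
    unfolding prefix_sum_snd_def by (simp add: sum.Sigma)
  also have "\<dots> = (\<Sum>(l, p)\<in>(SIGMA l:{..<k}. {..l}). f p (l - p))"
    by (rule sum.reindex_bij_witness[where j = "\<lambda>(p, i). (p + i, p)" and i = "\<lambda>(l, i). (i, l - i)"])
       auto
  also have "\<dots> = (\<Sum>l<k. \<Sum>p\<le>l. f p (l - p))"
    by (simp add: sum.Sigma)
  finally show ?thesis .
qed

lemma inverse_one_minus_X_nth:
  "fps_nth (inverse (1 - fps_X) * F) k = (\<Sum>l\<le>k. fps_nth F l)" for F :: "real fps"
proof (induction k)
  let ?G = "inverse (1 - fps_X) * F"
  have *: "?G = F + fps_X * ?G"
    using one_minus_X by algebra
  { case 0 show ?case by simp }
  case (Suc k)
  have "fps_nth ?G (Suc k) = fps_nth F (Suc k) + fps_nth ?G k"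
    by (subst *) simp
  with Suc show ?case by simp
qed

text \<open>
  Summing a prefix sum over an antidiagonal yields the sum over all lower antidiagonals, in either
  direction. So increasing \<open>n\<close> multiplies the series by \<open>1 + 2t/(1 - t) = (1 + t)/(1 - t)\<close>.
\<close>

lemma parity_series_0: "parity_series 0 n = gamma_series n 1"
proof (induction n)
  case 0
  have "fps_nth (inverse (1 - fps_X) * (inverse (1 - fps_X) * 1)) k = real k + 1" for k
    unfolding inverse_one_minus_X_nth by (simp add: fps_one_def)
  then have "inverse (1 - fps_X) * inverse (1 - fps_X) = Abs_fps (\<lambda>k. real k + 1)"
    by (intro fps_ext) simp
  then show ?case
    by (simp add: parity_series_def gamma_series_def compose_gamma power2_eq_square add.commute)
next
  case (Suc n)
  let ?T = "parity_series 0 n"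
  have "fps_nth (parity_series 0 (Suc n)) k = fps_nth ((1 + fps_X) * inverse (1 - fps_X) * ?T) k" for k
  proof -
    have "fps_nth (parity_series 0 (Suc n)) k = fps_nth ?T k + 2 * (\<Sum>l<k. fps_nth ?T l)"
      by (simp del: slice_count.simps
          add: parity_series_def slice_count_Suc sum.distrib sum_antidiagonal_prefix_sum_fst sum_antidiagonal_prefix_sum_snd)
         (simp add: slice_count_Suc sum.distrib sum_antidiagonal_prefix_sum_fst sum_antidiagonal_prefix_sum_snd)
    also have "\<dots> = (\<Sum>l\<le>k. fps_nth ?T l) + (\<Sum>l<k. fps_nth ?T l)"
      by (simp add: lessThan_Suc_atMost[symmetric])
    also have "\<dots> = fps_nth ((1 + fps_X) * (inverse (1 - fps_X) * ?T)) k"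
      by (cases k) (simp_all add: distrib_right inverse_one_minus_X_nth lessThan_Suc_atMost)
    finally show ?thesis by (simp only: mult.assoc)
  qed
  then show ?case
    unfolding Suc by (intro fps_ext) (simp add: gamma_series_def compose_gamma mult_ac)
qed

lemma gamma_poly_0: "gamma_poly 0 n = 1"
  by (simp add: gamma_poly_def)

lemma parity_series_1:
  "parity_series (Suc 0) n = gamma_series (Suc n) (gamma_poly (Suc 0) n)"
proof -
  have "slice_count (Suc 0) p (k - p) = real k + 1" if "p \<le> k" for p k
    using that by simp
  then have "parity_series (Suc 0) n = fps_deriv (fps_X * parity_series 0 n)"
    by (intro fps_ext)
       (simp del: slice_count.simps(2) fps_deriv_mult add: fps_nth_deriv_X_mult parity_series_def sum_distrib_left add.commute)
  also have "\<dots> = gamma_series (n + 1) (gamma_op n 1)"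
    unfolding parity_series_0 gamma_series_deriv ..
  also have "gamma_op n 1 = gamma_poly (Suc 0) n"
    by (simp add: gamma_op_def gamma_poly_def monom_altdef)
  finally show ?thesis by simp
qed

text \<open>
  The series and the closed form obey the same recurrence, which reaches \<open>m + 2\<close> from \<open>m\<close> and \<open>m + 1\<close> while
  shifting \<open>n\<close>; hence the induction is on \<open>m\<close> for all \<open>n\<close> simultaneously.
\<close>

lemma parity_series_eq: "parity_series m n = gamma_series (m + n) (gamma_poly m n)"
proof (induction m arbitrary: n rule: induct_nat_012)
  case 0
  show ?case by (simp add: parity_series_0 gamma_poly_0)
next
  case 1
  show ?case by (simp add: parity_series_1)
next
  case (ge2 m)
  have "fps_const ((real m + 2)\<^sup>2) * parity_series (Suc (Suc m)) n
    = fps_const ((real m + 2)\<^sup>2) * gamma_series (m + n + 2) (gamma_poly (Suc (Suc m)) n)"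
    unfolding parity_series_recurrence ge2 gamma_series_deriv gamma_series_linear[symmetric]
      gamma_poly_recurrence
    unfolding gamma_series_linear gamma_series_shift
    by simp
  moreover have "fps_const ((real m + 2)\<^sup>2) \<noteq> 0" by (simp add: fps_const_nonzero_eq_nonzero)
  ultimately show ?case by simp
qed

section \<open>The Ehrhart series\<close>

definition ehrhart_series :: "nat \<Rightarrow> real poly \<Rightarrow> real fps" where
  "ehrhart_series N p = (1 + fps_X) * gamma_series N p"

text \<open>
  The action on \<open>p\<close> of the map \<open>F \<mapsto> F + 2 t F'\<close>, which multiplies the \<open>k\<close>-th coefficient by \<open>2k + 1\<close>.
\<close>

definition ehrhart_op :: "nat \<Rightarrow> real poly \<Rightarrow> real poly" where
  "ehrhart_op N p = smult 2 (gamma_op N p) - [:1, -1:] * p"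

lemma ehrhart_series_linear:
  "ehrhart_series N (p + q) = ehrhart_series N p + ehrhart_series N q"
  "ehrhart_series N (p - q) = ehrhart_series N p - ehrhart_series N q"
  "ehrhart_series N (smult c p) = fps_const c * ehrhart_series N p"
  by (simp_all add: ehrhart_series_def gamma_series_linear algebra_simps)

lemma ehrhart_series_shift:
  "ehrhart_series (N + 2) ([:1, -1:] * p) = ehrhart_series N p"
  unfolding ehrhart_series_def gamma_series_shift ..

text \<open>
  For \<open>E = (1 + t) F\<close> one has \<open>E + 2 t E' = 2 (1 + t) (t F)' - (1 - t) F\<close>. The first term is given by the
  previous operator, and the factor \<open>1 - t\<close> in the second is absorbed by the shift by
  \<open>1 - y\<close>.
\<close>

lemma ehrhart_series_deriv:
  "ehrhart_series N p + 2 * fps_X * fps_deriv (ehrhart_series N p)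
     = ehrhart_series (N + 1) (ehrhart_op N p)"
proof -
  let ?F = "gamma_series N p"
  have "(1 - fps_X) * ?F = (1 + fps_X) * gamma_series (N + 1) ([:1, -1:] * p)"
  proof -
    have *: "gamma_series (N + 2) ([:1, -1:] * p) * (1 - fps_X)
      = (1 + fps_X) * (gamma_series (N + 1) ([:1, -1:] * p) * (inverse (1 - fps_X) * (1 - fps_X)))"
      unfolding gamma_series_def by (simp add: mult_ac)
    have "inverse (1 - fps_X) * (1 - fps_X :: real fps) = 1" using one_minus_X by (simp only: mult.commute)
    with * show ?thesis unfolding gamma_series_shift by (simp only: mult.commute[of _ "1 - fps_X"] mult_1_right) 
  qed
  moreover have "ehrhart_series N p + 2 * fps_X * fps_deriv (ehrhart_series N p)
     = 2 * (1 + fps_X) * fps_deriv (fps_X * ?F) - (1 - fps_X) * ?F"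
    unfolding ehrhart_series_def by (simp add: algebra_simps)
  moreover have "fps_const 2 = (2 :: real fps)"
    by (simp add: numeral_fps_const)
  ultimately show ?thesis
    unfolding gamma_series_deriv ehrhart_op_def ehrhart_series_linear
    by (simp only: ehrhart_series_def mult.assoc)
qed

lemma ehrhart_series_nth:
  "fps_nth (ehrhart_series (m + n) (gamma_poly m n)) k
     = (\<Sum>p\<le>k. slice_count m p (k - p) * slice_count n p (k - p))
       + (\<Sum>p<k. slice_count m p (k - 1 - p) * slice_count n p (k - 1 - p))"
  unfolding ehrhart_series_def parity_series_eq[symmetric]
  by (cases k) (simp_all add: parity_series_def distrib_right lessThan_Suc_atMost)

section \<open>Lattice points of the dilated polytope\<close>

text \<open>
  The sign in the second block makes the balance condition of a flow read \<open>sum_list as = sum_list bs\<close>.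
\<close>

definition lattice_vector :: "int list \<Rightarrow> int list \<Rightarrow> (nat + nat) \<Rightarrow>\<^sub>0 real" where
  "lattice_vector as bs = Abs_poly_mapping (\<lambda>v. case v of
     Inl i \<Rightarrow> if i < length as then real_of_int (as ! i) else 0
   | Inr j \<Rightarrow> if j < length bs then - real_of_int (bs ! j) else 0)"

lemma lookup_lattice_vector:
  "Poly_Mapping.lookup (lattice_vector as bs) (Inl i) = (if i < length as then real_of_int (as ! i) else 0)"
  "Poly_Mapping.lookup (lattice_vector as bs) (Inr i) = (if i < length bs then - real_of_int (bs ! i) else 0)"
proof -
  let ?f = "\<lambda>v. case v of
     Inl i \<Rightarrow> if i < length as then real_of_int (as ! i) else 0
   | Inr j \<Rightarrow> if j < length bs then - real_of_int (bs ! j) else 0"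
  have "{v. ?f v \<noteq> 0} \<subseteq> Inl ` {..<length as} \<union> Inr ` {..<length bs}"
  proof
    fix v assume "v \<in> {v. ?f v \<noteq> 0}"
    then show "v \<in> Inl ` {..<length as} \<union> Inr ` {..<length bs}"
      by (cases v) (auto split: if_splits)
  qed
  then have "finite {v. ?f v \<noteq> 0}" by (rule finite_subset) simp
  then have "Poly_Mapping.lookup (lattice_vector as bs) = ?f"
    unfolding lattice_vector_def by (simp add: Abs_poly_mapping_inverse)
  then show "Poly_Mapping.lookup (lattice_vector as bs) (Inl i) = (if i < length as then real_of_int (as ! i) else 0)"
    "Poly_Mapping.lookup (lattice_vector as bs) (Inr i) = (if i < length bs then - real_of_int (bs ! i) else 0)"
    by simp_all
qed

lemma lattice_vector_inject:
  assumes "length as = length as'" "length bs = length bs'" "lattice_vector as bs = lattice_vector as' bs'"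
  shows "as = as' \<and> bs = bs'"
proof -
  have "as ! i = as' ! i" if "i < length as" for i
    using arg_cong[OF assms(3), of "\<lambda>x. Poly_Mapping.lookup x (Inl i)"] that assms(1)
    by (simp add: lookup_lattice_vector)
  moreover have "bs ! i = bs' ! i" if "i < length bs" for i
    using arg_cong[OF assms(3), of "\<lambda>x. Poly_Mapping.lookup x (Inr i)"] that assms(2)
    by (simp add: lookup_lattice_vector)
  ultimately show ?thesis using assms(1,2) by (auto intro: nth_equalityI)
qed

definition edge_vector :: "nat \<Rightarrow> nat \<Rightarrow> (nat + nat) \<Rightarrow>\<^sub>0 real" where
  "edge_vector i j = Poly_Mapping.single (Inl i) 1 - Poly_Mapping.single (Inr j) 1"

abbreviation bipartite_polytope :: "nat \<Rightarrow> nat \<Rightarrow> ((nat + nat) \<Rightarrow>\<^sub>0 real) set" where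
  "bipartite_polytope m n \<equiv> symmetric_edge_polytope (complete_bipartite_edges m n)"

lemma bipartite_polytope_eq:
  "bipartite_polytope m n = convex hull (\<Union>i<m. \<Union>j<n. {edge_vector i j, - edge_vector i j})"
proof -
  have "(\<Union>(v, w)\<in>{(v, w). {v, w} \<in> complete_bipartite_edges m n}.
       {Poly_Mapping.single v 1 - Poly_Mapping.single w 1,
        - (Poly_Mapping.single v 1 - Poly_Mapping.single w (1::real))})
     = (\<Union>i<m. \<Union>j<n. {edge_vector i j, - edge_vector i j})" (is "?L = ?R")
  proof (intro equalityI subsetI)
    fix x assume "x \<in> ?L"
    then obtain v w i j where *: "{v, w} = {Inl i, Inr j}" "i < m" "j < n"
      "x \<in> {Poly_Mapping.single v 1 - Poly_Mapping.single w 1,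
        - (Poly_Mapping.single v 1 - Poly_Mapping.single w (1::real))}"
      by (auto simp: complete_bipartite_edges_def)
    from *(1) have "v = Inl i \<and> w = Inr j \<or> v = Inr j \<and> w = Inl i" by (auto simp: doubleton_eq_iff)
    with *(4) have "x \<in> {edge_vector i j, - edge_vector i j}" by (auto simp: edge_vector_def)
    with *(2,3) show "x \<in> ?R" by auto
  next
    fix x assume "x \<in> ?R"
    then show "x \<in> ?L" by (fastforce simp: complete_bipartite_edges_def edge_vector_def)
  qed
  then show ?thesis by (simp add: symmetric_edge_polytope_def)
qed

lemma edge_vector_in_polytope:
  assumes "i < m" "j < n"
  shows "edge_vector i j \<in> bipartite_polytope m n" "- edge_vector i j \<in> bipartite_polytope m n"
  unfolding bipartite_polytope_eq using assms by (auto intro!: hull_inc)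

lemma convex_bipartite_polytope: "convex (bipartite_polytope m n)"
  by (simp add: symmetric_edge_polytope_def convex_convex_hull)

lemma zero_in_polytope:
  assumes "0 < m" "0 < n"
  shows "0 \<in> bipartite_polytope m n"
proof -
  have "(1 / 2) *\<^sub>R edge_vector 0 0 + (1 / 2) *\<^sub>R (- edge_vector 0 0) \<in> bipartite_polytope m n"
    using convexD[OF convex_bipartite_polytope edge_vector_in_polytope[OF assms], of "1/2" "1/2"]
    by simp
  then show ?thesis by simp
qed

lemma lookup_scaleR: "Poly_Mapping.lookup (c *\<^sub>R x) v = c * Poly_Mapping.lookup x v"
  for x :: "'v \<Rightarrow>\<^sub>0 real"
  by (simp add: scaleR_poly_mapping_def Poly_Mapping.map.rep_eq when_def)

text \<open>
  All five conditions are convex and hold for the vertices.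
\<close>

lemma polytope_bounds:
  assumes "x \<in> bipartite_polytope m n"
  shows "i \<ge> m \<Longrightarrow> Poly_Mapping.lookup x (Inl i) = 0"
    and "j \<ge> n \<Longrightarrow> Poly_Mapping.lookup x (Inr j) = 0"
    and "(\<Sum>i<m. Poly_Mapping.lookup x (Inl i)) = (\<Sum>j<n. - Poly_Mapping.lookup x (Inr j))"
    and "(\<Sum>i<m. \<bar>Poly_Mapping.lookup x (Inl i)\<bar>) \<le> 1"
    and "(\<Sum>j<n. \<bar>Poly_Mapping.lookup x (Inr j)\<bar>) \<le> 1"
proof -
  let ?l = "\<lambda>(x :: (nat + nat) \<Rightarrow>\<^sub>0 real) i. Poly_Mapping.lookup x (Inl i)"
  let ?r = "\<lambda>(x :: (nat + nat) \<Rightarrow>\<^sub>0 real) i. Poly_Mapping.lookup x (Inr i)"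
  let ?C = "{x. (\<forall>i\<ge>m. ?l x i = 0) \<and> (\<forall>j\<ge>n. ?r x j = 0) \<and> (\<Sum>i<m. ?l x i) = (\<Sum>j<n. - ?r x j)
     \<and> (\<Sum>i<m. \<bar>?l x i\<bar>) \<le> 1 \<and> (\<Sum>j<n. \<bar>?r x j\<bar>) \<le> 1}"
  have conv: "(\<Sum>i\<in>I. \<bar>u * f i + v * g i\<bar>) \<le> 1"
    if "(\<Sum>i\<in>I. \<bar>f i\<bar>) \<le> 1" "(\<Sum>i\<in>I. \<bar>g i\<bar>) \<le> 1" "u \<ge> 0" "v \<ge> 0" "u + v = 1"
    for u v :: real and f g :: "nat \<Rightarrow> real" and I
  proof -
    have "(\<Sum>i\<in>I. \<bar>u * f i + v * g i\<bar>) \<le> (\<Sum>i\<in>I. u * \<bar>f i\<bar> + v * \<bar>g i\<bar>)"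
      using that by (intro sum_mono order.trans[OF abs_triangle_ineq]) (simp add: abs_mult)
    also have "\<dots> = u * (\<Sum>i\<in>I. \<bar>f i\<bar>) + v * (\<Sum>i\<in>I. \<bar>g i\<bar>)"
      by (simp add: sum.distrib sum_distrib_left)
    also have "\<dots> \<le> 1" using that by (intro convex_bound_le) auto
    finally show ?thesis .
  qed
  have "convex ?C"
    by (rule convexI)
       (simp add: lookup_add lookup_scaleR sum.distrib sum_distrib_left[symmetric] sum_negf conv)
  moreover have "edge_vector i j \<in> ?C" "- edge_vector i j \<in> ?C" if "i < m" "j < n" for i j
    using that
    by (auto simp: edge_vector_def lookup_minus lookup_single when_def if_distrib[of abs]
        if_distrib[of uminus] cong: if_cong)
  then have "(\<Union>i<m. \<Union>j<n. {edge_vector i j, - edge_vector i j}) \<subseteq> ?C" by blast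
  ultimately have "bipartite_polytope m n \<subseteq> ?C"
    unfolding bipartite_polytope_eq by (intro hull_minimal)
  with assms have "x \<in> ?C" by blast
  then show "i \<ge> m \<Longrightarrow> Poly_Mapping.lookup x (Inl i) = 0"
    and "j \<ge> n \<Longrightarrow> Poly_Mapping.lookup x (Inr j) = 0"
    and "(\<Sum>i<m. Poly_Mapping.lookup x (Inl i)) = (\<Sum>j<n. - Poly_Mapping.lookup x (Inr j))"
    and "(\<Sum>i<m. \<bar>Poly_Mapping.lookup x (Inl i)\<bar>) \<le> 1"
    and "(\<Sum>j<n. \<bar>Poly_Mapping.lookup x (Inr j)\<bar>) \<le> 1"
    by blast+
qed

lemma sum_list_int_update:
  "i < length xs \<Longrightarrow> sum_list (xs[i := y]) = sum_list xs + y - xs ! i" for xs :: "int list"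
  by (induction xs arbitrary: i) (auto split: nat.split)

lemma sum_list_abs_update:
  "i < length xs \<Longrightarrow> sum_list (map abs (xs[i := y])) = sum_list (map abs xs) + \<bar>y\<bar> - \<bar>xs ! i\<bar>"
  for xs :: "int list"
  by (simp add: map_update sum_list_int_update)

lemma sum_list_abs_nonneg: "0 \<le> sum_list (map abs xs)" for xs :: "int list"
  by (induction xs) auto

lemma sum_list_abs_eq_0: "sum_list (map abs xs) = 0 \<longleftrightarrow> (\<forall>i<length xs. xs ! i = 0)" for xs :: "int list"
proof -
  have "sum_list (map abs xs) = 0 \<longleftrightarrow> (\<forall>x\<in>set (map abs xs). x = 0)"
    by (rule sum_list_nonneg_eq_0_iff) auto
  then show ?thesis by (simp add: all_set_conv_all_nth)
qed

lemma nonneg_iff_sum_list_eq: "(\<forall>i<length xs. 0 \<le> xs ! i) \<longleftrightarrow> sum_list xs = sum_list (map abs xs)"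
  for xs :: "int list"
proof (induction xs)
  case (Cons x xs)
  have "(\<forall>i<length (x # xs). 0 \<le> (x # xs) ! i) \<longleftrightarrow> 0 \<le> x \<and> (\<forall>i<length xs. 0 \<le> xs ! i)"
    by (auto simp: nth_Cons split: nat.split)
  also have "\<dots> \<longleftrightarrow> 0 \<le> x \<and> sum_list xs = sum_list (map abs xs)" by (simp add: Cons)
  also have "\<dots> \<longleftrightarrow> sum_list (x # xs) = sum_list (map abs (x # xs))"
    using abs_sum_list_le[of xs] by auto
  finally show ?case .
qed simp

lemma nonpos_iff_sum_list_eq: "(\<forall>i<length xs. xs ! i \<le> 0) \<longleftrightarrow> sum_list xs = - sum_list (map abs xs)"
  for xs :: "int list"
proof (induction xs)
  case (Cons x xs)
  have "(\<forall>i<length (x # xs). (x # xs) ! i \<le> 0) \<longleftrightarrow> x \<le> 0 \<and> (\<forall>i<length xs. xs ! i \<le> 0)"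
    by (auto simp: nth_Cons split: nat.split)
  also have "\<dots> \<longleftrightarrow> x \<le> 0 \<and> sum_list xs = - sum_list (map abs xs)" by (simp add: Cons)
  also have "\<dots> \<longleftrightarrow> sum_list (x # xs) = - sum_list (map abs (x # xs))"
    using abs_sum_list_le[of xs] by auto
  finally show ?case .
qed simp

text \<open>
  One unit is removed along an edge, lowering the larger norm. If both norms equal \<open>k + 1\<close>, equality of the
  sums provides entries of the same sign on both sides. If only one does, then parity makes the other at
  most \<open>k - 1\<close>, so any edge at a nonzero entry of the larger vector will do even if it enlarges the other
  norm.
\<close>

lemma lattice_vector_step:
  assumes "as \<noteq> []" "bs \<noteq> []" "sum_list as = sum_list bs"
    and "sum_list (map abs as) \<le> int (Suc k)" "sum_list (map abs bs) \<le> int (Suc k)"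
    and big: "sum_list (map abs as) = int (Suc k) \<or> sum_list (map abs bs) = int (Suc k)"
  obtains i j e where "i < length as" "j < length bs" "e = 1 \<or> e = - 1"
    "sum_list (map abs (as[i := as ! i - e])) \<le> int k"
    "sum_list (map abs (bs[j := bs ! j - e])) \<le> int k"
proof -
  let ?A = "sum_list (map abs as)" and ?B = "sum_list (map abs bs)"
  note main = that
  have goal: thesis if "i < length as" "j < length bs" "e = 1 \<or> e = - 1"
    "?A + \<bar>as ! i - e\<bar> - \<bar>as ! i\<bar> \<le> int k" "?B + \<bar>bs ! j - e\<bar> - \<bar>bs ! j\<bar> \<le> int k" for i j e
    using that(4,5) unfolding sum_list_abs_update[OF that(1), symmetric]
      sum_list_abs_update[OF that(2), symmetric] by (rule main[OF that(1-3)])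
  have par: "even (?A - ?B)"
    using even_sum_list_abs[of as] even_sum_list_abs[of bs] assms(3) by presburger
  consider "?A = int (Suc k)" "?B = int (Suc k)" | "?A = int (Suc k)" "?B < int k"
    | "?B = int (Suc k)" "?A < int k"
  proof -
    have "?B \<noteq> int k" if "?A = int (Suc k)" using par that by auto
    moreover have "?A \<noteq> int k" if "?B = int (Suc k)" using par that by auto
    ultimately show thesis using assms(4,5) big that by linarith
  qed
  then show thesis
  proof cases
    case 1
    show thesis
    proof (cases "\<exists>i<length as. 0 < as ! i")
      case True
      then have "\<not> (\<forall>i<length bs. bs ! i \<le> 0)"
        using nonpos_iff_sum_list_eq[of as] nonpos_iff_sum_list_eq[of bs] assms(3) 1 by force
      with True obtain i j where "i < length as" "0 < as ! i" "j < length bs" "0 < bs ! j" by force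
      then show thesis using 1 by (intro goal[of i j 1]) auto
    next
      case False
      then have "\<forall>i<length as. as ! i \<le> 0" by force
      then have "sum_list bs = - int (Suc k)"
        using nonpos_iff_sum_list_eq[of as] assms(3) 1 by simp
      then have "\<not> (\<forall>i<length as. 0 \<le> as ! i)" "\<not> (\<forall>i<length bs. 0 \<le> bs ! i)"
        using nonneg_iff_sum_list_eq[of as] nonneg_iff_sum_list_eq[of bs] assms(3) 1 by auto
      then obtain i j where "i < length as" "as ! i < 0" "j < length bs" "bs ! j < 0" by force
      then show thesis using 1 by (intro goal[of i j "- 1"]) auto
    qed
  next
    case 2
    then have "?A \<noteq> 0" by simp
    then obtain i where i: "i < length as" "as ! i \<noteq> 0" unfolding sum_list_abs_eq_0 by blast
    show thesis
      by (rule goal[of i 0 "sgn (as ! i)"]) (use 2 i assms(2) in \<open>auto simp: sgn_if\<close>)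
  next
    case 3
    then have "?B \<noteq> 0" by simp
    then obtain i where i: "i < length bs" "bs ! i \<noteq> 0" unfolding sum_list_abs_eq_0 by blast
    show thesis
      by (rule goal[of 0 i "sgn (bs ! i)"]) (use 3 i assms(1) in \<open>auto simp: sgn_if\<close>)
  qed
qed

text \<open>
  Peeling off a vertex \<open>y\<close> leaves a point \<open>k x\<close> with \<open>x\<close> in the polytope, and \<open>k x + y\<close> is \<open>k + 1\<close> times a convex
  combination of \<open>x\<close> and \<open>y\<close>. If both norms are already at most \<open>k\<close>, the role of \<open>y\<close> is taken by the origin.
\<close>

lemma lattice_vector_in_dilate:
  assumes "as \<noteq> []" "bs \<noteq> []" "sum_list as = sum_list bs"
    and "sum_list (map abs as) \<le> int k" "sum_list (map abs bs) \<le> int k"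
  shows "lattice_vector as bs \<in> (\<lambda>x. real k *\<^sub>R x) ` bipartite_polytope (length as) (length bs)"
  using assms
proof (induction k arbitrary: as bs)
  case 0
  then have "sum_list (map abs as) = 0" "sum_list (map abs bs) = 0"
    using sum_list_abs_nonneg[of as] sum_list_abs_nonneg[of bs] by linarith+
  then have "lattice_vector as bs = 0"
    unfolding sum_list_abs_eq_0
    by (intro poly_mapping_eqI) (case_tac k, simp_all add: lookup_lattice_vector)
  with zero_in_polytope[of "length as" "length bs"] 0 show ?case by (simp add: image_iff) blast
next
  case (Suc k)
  let ?P = "bipartite_polytope (length as) (length bs)"
  have combine: "real k *\<^sub>R x + y \<in> (\<lambda>x. real (Suc k) *\<^sub>R x) ` ?P" if "x \<in> ?P" "y \<in> ?P" for x y
  proof -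
    have "(real k / real (Suc k)) *\<^sub>R x + (1 / real (Suc k)) *\<^sub>R y \<in> ?P"
      using that by (intro convexD[OF convex_bipartite_polytope]) (simp_all add: field_simps)
    moreover have "real k *\<^sub>R x + y
      = real (Suc k) *\<^sub>R ((real k / real (Suc k)) *\<^sub>R x + (1 / real (Suc k)) *\<^sub>R y)"
      by (simp add: scaleR_add_right del: of_nat_Suc)
    ultimately show ?thesis by (rule rev_image_eqI)
  qed
  show ?case
  proof (cases "sum_list (map abs as) \<le> int k \<and> sum_list (map abs bs) \<le> int k")
    case True
    with Suc.IH[of as bs] Suc.prems obtain x where "x \<in> ?P" "lattice_vector as bs = real k *\<^sub>R x" by auto
    with combine[of x 0] zero_in_polytope[of "length as" "length bs"] Suc.prems(1,2) show ?thesis by simp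
  next
    case False
    with Suc.prems(4,5) have "sum_list (map abs as) = int (Suc k) \<or> sum_list (map abs bs) = int (Suc k)"
      by auto
    from lattice_vector_step[OF Suc.prems this] obtain i j e where *:
      "i < length as" "j < length bs" "e = 1 \<or> e = - 1"
      "sum_list (map abs (as[i := as ! i - e])) \<le> int k"
      "sum_list (map abs (bs[j := bs ! j - e])) \<le> int k" .
    have "lattice_vector (as[i := as ! i - e]) (bs[j := bs ! j - e]) \<in> (\<lambda>x. real k *\<^sub>R x) ` ?P"
      using Suc.IH[OF _ _ _ *(4,5)] Suc.prems(1-3) *(1,2) by (simp add: sum_list_int_update)
    then obtain x where x: "x \<in> ?P"
      "lattice_vector (as[i := as ! i - e]) (bs[j := bs ! j - e]) = real k *\<^sub>R x" by auto
    have "lattice_vector as bs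
      = lattice_vector (as[i := as ! i - e]) (bs[j := bs ! j - e]) + of_int e *\<^sub>R edge_vector i j"
    proof (rule poly_mapping_eqI)
      fix v
      show "Poly_Mapping.lookup (lattice_vector as bs) v = Poly_Mapping.lookup
        (lattice_vector (as[i := as ! i - e]) (bs[j := bs ! j - e]) + of_int e *\<^sub>R edge_vector i j) v"
        using *(1,2) by (cases v) (auto simp: lookup_lattice_vector lookup_add lookup_scaleR
            edge_vector_def lookup_minus lookup_single when_def nth_list_update)
    qed
    moreover have "of_int e *\<^sub>R edge_vector i j \<in> ?P"
      using *(3) edge_vector_in_polytope[OF *(1,2)] by auto
    ultimately show ?thesis using combine[OF x(1)] x(2) by simp
  qed
qed

definition balanced_pairs :: "nat \<Rightarrow> nat \<Rightarrow> nat \<Rightarrow> (int list \<times> int list) set" where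
  "balanced_pairs m n k = (\<Union>d. l1_slice m k d \<times> l1_slice n k d)"

text \<open>
  One inclusion reads off the convex conditions on the polytope, scaled by \<open>k\<close>; integrality makes the two
  blocks integer vectors. The other is the peeling argument.
\<close>

lemma lattice_points_eq:
  assumes "0 < m" "0 < n"
  shows "(\<lambda>x. real k *\<^sub>R x) ` bipartite_polytope m n \<inter> integer_points
    = (\<lambda>(as, bs). lattice_vector as bs) ` balanced_pairs m n k"
proof (intro equalityI subsetI)
  fix x assume x: "x \<in> (\<lambda>x. real k *\<^sub>R x) ` bipartite_polytope m n \<inter> integer_points"
  then obtain y where y: "y \<in> bipartite_polytope m n" "x = real k *\<^sub>R y" by auto
  have int: "Poly_Mapping.lookup x v \<in> \<int>" for v using x by (simp add: integer_points_def)
  define as where "as = map (\<lambda>i. \<lfloor>Poly_Mapping.lookup x (Inl i)\<rfloor>) [0..<m]"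
  define bs where "bs = map (\<lambda>j. \<lfloor>- Poly_Mapping.lookup x (Inr j)\<rfloor>) [0..<n]"
  have fl: "real_of_int \<lfloor>Poly_Mapping.lookup x v\<rfloor> = Poly_Mapping.lookup x v"
    "real_of_int \<lfloor>- Poly_Mapping.lookup x v\<rfloor> = - Poly_Mapping.lookup x v" for v
    using int[of v] by (auto elim!: Ints_cases)
  note b = polytope_bounds[OF y(1)]
  have lk: "Poly_Mapping.lookup x v = real k * Poly_Mapping.lookup y v" for v
    by (simp add: y lookup_scaleR)
  have z1: "Poly_Mapping.lookup x (Inl i) = 0" if "m \<le> i" for i using b(1) that by (simp add: lk)
  have z2: "Poly_Mapping.lookup x (Inr j) = 0" if "n \<le> j" for j using b(2) that by (simp add: lk)
  have "x = lattice_vector as bs"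
  proof (intro poly_mapping_eqI)
    fix v
    show "Poly_Mapping.lookup x v = Poly_Mapping.lookup (lattice_vector as bs) v"
      by (cases v) (auto simp: lookup_lattice_vector as_def bs_def fl z1 z2)
  qed
  moreover have "sum_list as = sum_list bs"
  proof -
    have "real_of_int (sum_list as) = (\<Sum>i<m. Poly_Mapping.lookup x (Inl i))"
      by (simp add: as_def interv_sum_list_conv_sum_set_nat fl atLeast0LessThan)
    also have "\<dots> = (\<Sum>j<n. - Poly_Mapping.lookup x (Inr j))"
      using b(3) by (simp add: lk sum_distrib_left[symmetric] sum_negf)
    also have "\<dots> = real_of_int (sum_list bs)"
      by (simp add: bs_def interv_sum_list_conv_sum_set_nat fl atLeast0LessThan)
    finally show ?thesis by simp
  qed
  moreover have "sum_list (map abs as) \<le> int k"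
  proof -
    have "real_of_int (sum_list (map abs as)) = (\<Sum>i<m. \<bar>Poly_Mapping.lookup x (Inl i)\<bar>)"
      by (simp add: as_def interv_sum_list_conv_sum_set_nat fl atLeast0LessThan comp_def)
    also have "\<dots> = real k * (\<Sum>i<m. \<bar>Poly_Mapping.lookup y (Inl i)\<bar>)"
      by (simp add: lk abs_mult sum_distrib_left)
    also have "\<dots> \<le> real k * 1" by (intro mult_left_mono b) simp
    finally show ?thesis by simp
  qed
  moreover have "sum_list (map abs bs) \<le> int k"
  proof -
    have "real_of_int (sum_list (map abs bs)) = (\<Sum>i<n. \<bar>Poly_Mapping.lookup x (Inr i)\<bar>)"
      by (simp add: bs_def interv_sum_list_conv_sum_set_nat fl atLeast0LessThan comp_def)
    also have "\<dots> = real k * (\<Sum>i<n. \<bar>Poly_Mapping.lookup y (Inr i)\<bar>)"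
      by (simp add: lk abs_mult sum_distrib_left)
    also have "\<dots> \<le> real k * 1" by (intro mult_left_mono b) simp
    finally show ?thesis by simp
  qed
  moreover have "length as = m" "length bs = n" by (simp_all add: as_def bs_def)
  ultimately have "(as, bs) \<in> balanced_pairs m n k" "x = lattice_vector as bs"
    by (auto simp: balanced_pairs_def l1_slice_def)
  then show "x \<in> (\<lambda>(as, bs). lattice_vector as bs) ` balanced_pairs m n k"
    by (auto simp: image_iff split: prod.splits)
next
  fix x assume "x \<in> (\<lambda>(as, bs). lattice_vector as bs) ` balanced_pairs m n k"
  then obtain as bs where x: "x = lattice_vector as bs" and *: "length as = m" "length bs = n"
    "sum_list as = sum_list bs" "sum_list (map abs as) \<le> int k" "sum_list (map abs bs) \<le> int k"
    by (auto simp: balanced_pairs_def l1_slice_def)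
  have "x \<in> (\<lambda>x. real k *\<^sub>R x) ` bipartite_polytope m n"
    using lattice_vector_in_dilate[of as bs k] * assms by (auto simp: x)
  moreover have "Poly_Mapping.lookup x v \<in> \<int>" for v
    unfolding x by (cases v) (auto simp: lookup_lattice_vector)
  ultimately show "x \<in> (\<lambda>x. real k *\<^sub>R x) ` bipartite_polytope m n \<inter> integer_points"
    by (simp add: integer_points_def)
qed

text \<open>
  The two unions collect the pairs whose common sum is congruent to \<open>k\<close> and to \<open>k - 1\<close> modulo 2; for
  \<open>k = 0\<close> the second is empty.
\<close>

lemma balanced_pairs_eq:
  "balanced_pairs m n k =
     (\<Union>p\<le>k. l1_slice m k (int p - int (k - p)) \<times> l1_slice n k (int p - int (k - p)))
   \<union> (\<Union>p<k. l1_slice m (k - 1) (int p - int (k - 1 - p)) \<times> l1_slice n (k - 1) (int p - int (k - 1 - p)))"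
  (is "_ = ?A \<union> ?B")
proof (intro equalityI subsetI)
  fix z assume "z \<in> balanced_pairs m n k"
  then obtain xs ys d where z: "z = (xs, ys)" "length xs = m" "length ys = n"
    "sum_list xs = d" "sum_list ys = d"
    and le: "sum_list (map abs xs) \<le> int k" "sum_list (map abs ys) \<le> int k"
    by (auto simp: balanced_pairs_def l1_slice_def)
  have d: "\<bar>d\<bar> \<le> sum_list (map abs xs)" "\<bar>d\<bar> \<le> sum_list (map abs ys)"
    using abs_sum_list_le[of xs] abs_sum_list_le[of ys] z by auto
  show "z \<in> ?A \<union> ?B"
  proof (cases "even (int k + d)")
    case True
    define p where "p = nat ((int k + d) div 2)"
    have "p \<le> k" "int p - int (k - p) = d" using True d le unfolding p_def by auto
    then have "p \<le> k" "z \<in> l1_slice m k (int p - int (k - p)) \<times> l1_slice n k (int p - int (k - p))"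
      using z le by (auto simp: l1_slice_def)
    then show ?thesis by blast
  next
    case False
    have "sum_list (map abs xs) \<noteq> int k" "sum_list (map abs ys) \<noteq> int k"
      using even_sum_list_abs[of xs] even_sum_list_abs[of ys] z False by auto
    then have le': "sum_list (map abs xs) \<le> int k - 1" "sum_list (map abs ys) \<le> int k - 1"
      using le by auto
    then have k: "1 \<le> k" using sum_list_abs_nonneg[of xs] by linarith
    define p where "p = nat ((int k - 1 + d) div 2)"
    have "p < k" "int p - int (k - 1 - p) = d" using False d le' k unfolding p_def by auto
    then have "p < k"
      "z \<in> l1_slice m (k - 1) (int p - int (k - 1 - p)) \<times> l1_slice n (k - 1) (int p - int (k - 1 - p))"
      using z le' k by (auto simp: l1_slice_def of_nat_diff)
    then show ?thesis by blast
  qed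
qed (auto simp: balanced_pairs_def l1_slice_def)

lemma card_balanced_pairs:
  "real (card (balanced_pairs (Suc m) (Suc n) k))
     = (\<Sum>p\<le>k. slice_count m p (k - p) * slice_count n p (k - p))
       + (\<Sum>p<k. slice_count m p (k - 1 - p) * slice_count n p (k - 1 - p))"
proof -
  define S where "S k p = l1_slice (Suc m) k (int p - int (k - p)) \<times> l1_slice (Suc n) k (int p - int (k - p))"
    for k p
  have card: "real (card (S k p)) = slice_count m p (k - p) * slice_count n p (k - p)" if "p \<le> k" for k p
    using card_l1_slice[of m p "k - p"] card_l1_slice[of n p "k - p"] that
    by (simp add: card_cartesian_product S_def)
  have fin: "finite (S k p)" for k p by (simp add: finite_l1_slice S_def)
  have sum_S: "sum_list (fst z) = int p - int (k - p)" if "z \<in> S k p" for z k p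
    using that by (auto simp: l1_slice_def S_def)
  have disj: "S k p \<inter> S k q = {}" if "p \<le> k" "q \<le> k" "p \<noteq> q" for k p q
  proof -
    have "int p - int (k - p) \<noteq> int q - int (k - q)" using that by auto
    then have False if "z \<in> S k p" "z \<in> S k q" for z
      using sum_S[OF that(1)] sum_S[OF that(2)] by (simp only:)
    then show ?thesis by blast
  qed
  have card_UN: "real (card (\<Union>p\<in>I. S k p)) = (\<Sum>p\<in>I. slice_count m p (k - p) * slice_count n p (k - p))"
    if "finite I" "I \<subseteq> {..k}" for I k
  proof -
    have "\<forall>p\<in>I. \<forall>q\<in>I. p \<noteq> q \<longrightarrow> S k p \<inter> S k q = {}"
    proof (intro ballI impI)
      fix p q assume "p \<in> I" "q \<in> I" "p \<noteq> q"
      with that(2) show "S k p \<inter> S k q = {}" by (intro disj) auto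
    qed
    then have "card (\<Union>p\<in>I. S k p) = (\<Sum>p\<in>I. card (S k p))"
      by (intro card_UN_disjoint that(1) ballI fin) (assumption | blast)+
    also have "real \<dots> = (\<Sum>p\<in>I. slice_count m p (k - p) * slice_count n p (k - p))"
      unfolding of_nat_sum using that by (intro sum.cong refl card) auto
    finally show ?thesis .
  qed
  have cross: "S k p \<inter> S (k - 1) q = {}" if "p \<le> k" "q < k" for p q
  proof -
    have e: "int p - int (k - p) = 2 * int p - int k" "int q - int (k - 1 - q) = 2 * int q - int k + 1"
      using that by simp_all
    have "int p - int (k - p) \<noteq> int q - int (k - 1 - q)"
      unfolding e by presburger
    then have False if "z \<in> S k p" "z \<in> S (k - 1) q" for z
      using sum_S[OF that(1)] sum_S[OF that(2)] by (simp only:)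
    then show ?thesis by blast
  qed
  have AB: "(\<Union>p\<le>k. S k p) \<inter> (\<Union>p<k. S (k - 1) p) = {}"
  proof (intro equals0I, elim IntE UN_E)
    fix z p q assume "p \<in> {..k}" "z \<in> S k p" "q \<in> {..<k}" "z \<in> S (k - 1) q"
    with cross[of p q] show False by auto
  qed
  have fins: "finite (\<Union>p\<le>k. S k p)" "finite (\<Union>p<k. S (k - 1) p)"
    by (simp_all add: fin)
  \<comment> \<open>The two unions are disjoint because the sums in them differ in parity.\<close>
  have "card (balanced_pairs (Suc m) (Suc n) k) = card (\<Union>p\<le>k. S k p) + card (\<Union>p<k. S (k - 1) p)"
    unfolding balanced_pairs_eq S_def[symmetric] by (rule card_Un_disjoint[OF fins AB])
  moreover have "{..<k} \<subseteq> {..k - 1}" by auto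
  ultimately show ?thesis
    by (simp only: of_nat_add card_UN finite_atMost finite_lessThan order_refl)
qed

lemma card_lattice_points:
  "real (card ((\<lambda>x. real k *\<^sub>R x) ` bipartite_polytope (Suc m) (Suc n) \<inter> integer_points))
     = fps_nth (ehrhart_series (m + n) (gamma_poly m n)) k"
proof -
  have "inj_on (\<lambda>(as, bs). lattice_vector as bs) (balanced_pairs (Suc m) (Suc n) k)"
  proof (rule inj_onI, clarify)
    fix as bs as' bs'
    assume "(as, bs) \<in> balanced_pairs (Suc m) (Suc n) k" "(as', bs') \<in> balanced_pairs (Suc m) (Suc n) k"
      and "lattice_vector as bs = lattice_vector as' bs'"
    then show "as = as' \<and> bs = bs'"
      by (intro lattice_vector_inject) (auto simp: balanced_pairs_def l1_slice_def)
  qed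
  then show ?thesis
    by (simp add: lattice_points_eq card_image card_balanced_pairs ehrhart_series_nth del: slice_count.simps)
qed

section \<open>Polynomiality of the counts\<close>

definition step_var :: "real fps" where
  "step_var = fps_X * inverse (1 - fps_X)"

text \<open>
  The coefficients of \<open>(t/(1-t))\<^sup>i / (1 - t)\<close> are the values \<open>k choose i\<close>, so these series are the generating
  functions of polynomials, presented in the Newton basis.
\<close>

definition newton_series :: "real poly \<Rightarrow> real fps" where
  "newton_series r = (fps_of_poly r oo step_var) * inverse (1 - fps_X)"

lemma step_var_0 [simp]: "fps_nth step_var 0 = 0"
  by (simp add: step_var_def)

lemma fps_X_power_compose: "fps_nth w 0 = 0 \<Longrightarrow> fps_X ^ i oo w = w ^ i" for w :: "real fps"
  by (simp flip: fps_compose_power)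

lemma nth_step_var_power: "fps_nth (step_var ^ i * inverse (1 - fps_X)) k = real (k choose i)"
proof (induction i arbitrary: k)
  case 0
  have "fps_nth (inverse (1 - fps_X) * (1 :: real fps)) k = 1"
    unfolding inverse_one_minus_X_nth by (simp add: fps_one_def)
  then show ?case by simp
next
  case (Suc i)
  have "step_var ^ Suc i * inverse (1 - fps_X) = fps_X * (inverse (1 - fps_X) * (step_var ^ i * inverse (1 - fps_X)))"
    by (simp add: step_var_def mult_ac)
  then have "fps_nth (step_var ^ Suc i * inverse (1 - fps_X)) k = (if k = 0 then 0 else \<Sum>l\<le>k - 1. real (l choose i))"
    by (simp only: fps_X_mult_nth inverse_one_minus_X_nth Suc)
  also have "\<dots> = real (k choose Suc i)"
    by (cases k) (simp_all add: sum_choose_upper of_nat_sum[symmetric] del: of_nat_sum binomial_Suc_Suc)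
  finally show ?case .
qed

lemma binomial_polynomial: "\<exists>q. \<forall>k::nat. poly q (real k) = real (k choose i)"
proof
  show "\<forall>k::nat. poly (smult (1 / fact i) (\<Prod>l<i. [:- real l, 1:])) (real k) = real (k choose i)"
    by (simp add: binomial_gbinomial gbinomial_prod_rev poly_prod atLeast0LessThan)
qed

lemma newton_series_polynomial: "\<exists>q. \<forall>k. poly q (real k) = fps_nth (newton_series r) k"
proof -
  obtain q where q: "poly (q i) (real k) = real (k choose i)" for i k
    using binomial_polynomial by metis
  have "fps_of_poly r oo step_var = (\<Sum>i\<le>degree r. fps_const (coeff r i) * step_var ^ i)"
    by (subst poly_as_sum_of_monoms[of r, symmetric])
       (simp add: fps_of_poly_sum fps_compose_sum_distrib fps_of_poly_monom fps_compose_mult_distrib fps_const_compose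
         fps_X_power_compose)
  then have "newton_series r = (\<Sum>i\<le>degree r. fps_const (coeff r i) * (step_var ^ i * inverse (1 - fps_X)))"
    by (simp add: newton_series_def sum_distrib_right mult.assoc)
  then have "poly (\<Sum>i\<le>degree r. smult (coeff r i) (q i)) (real k) = fps_nth (newton_series r) k" for k
    by (simp add: poly_sum q nth_step_var_power fps_sum_nth)
  then show ?thesis by blast
qed

lemma compose_step_var_linear: "fps_of_poly [:a, b:] oo step_var = fps_const a + fps_const b * step_var"
  by (simp add: fps_compose_add_distrib fps_compose_mult_distrib fps_of_poly_pCons mult.commute)

text \<open>
  With \<open>w = t/(1-t)\<close> one has \<open>(1+t)/(1-t) = 1 + 2w\<close> and \<open>t/(1-t)\<^sup>2 = w (1 + w)\<close>. The bound on \<open>i\<close> ensures that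
  the power of \<open>1 + t\<close> left after cancelling the denominators of \<open>4t/(1+t)\<^sup>2\<close> is not negative.
\<close>

lemma ehrhart_series_monom:
  assumes "2 * i \<le> N + 1"
  shows "ehrhart_series N (monom c i)
    = newton_series (smult (c * 4 ^ i) (([:0, 1:] * [:1, 1:]) ^ i * [:1, 2:] ^ (N + 1 - 2 * i)))"
proof -
  define A B a b where "A = (1 + fps_X :: real fps)" "B = (1 - fps_X :: real fps)"
    "a = inverse A" "b = inverse B"
  note defs = this
  have r: "A * a = 1" "B * b = 1" "A = 1 + fps_X" "B = 1 - fps_X"
    using one_plus_X one_minus_X by (simp_all add: defs)
  have s: "1 + 2 * (fps_X * b) = A * b" "fps_X * b * (1 + fps_X * b) = fps_X * b\<^sup>2"
    using r by algebra+
  have g: "A\<^sup>2 * b\<^sup>2 * (4 * fps_X * a\<^sup>2) = 4 * (fps_X * b\<^sup>2)"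
    using r by algebra
  obtain d where d: "N + 1 = 2 * i + d" using assms le_Suc_ex by blast
  then have dd: "N + 1 - 2 * i = d" by simp
  have m: "fps_of_poly (monom c i) oo gamma_var = fps_const c * gamma_var ^ i"
    by (simp add: fps_of_poly_monom fps_compose_mult_distrib fps_const_compose fps_X_power_compose)
  have "ehrhart_series N (monom c i) = A ^ (N + 1) * b ^ (N + 1) * b * (fps_const c * (4 * fps_X * a\<^sup>2) ^ i)"
    unfolding ehrhart_series_def gamma_series_def m by (simp add: defs gamma_var_def mult_ac)
  also have "\<dots> = fps_const c * (A\<^sup>2 * b\<^sup>2 * (4 * fps_X * a\<^sup>2)) ^ i * (A * b) ^ d * b"
    unfolding d by (simp only: power_add power_mult power_mult_distrib) (simp only: mult_ac)
  also have "\<dots> = fps_const c * 4 ^ i * ((fps_X * b * (1 + fps_X * b)) ^ i * (1 + 2 * (fps_X * b)) ^ d) * b"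
    unfolding g s by (simp add: power_mult_distrib mult_ac)
  also have "\<dots> = newton_series (smult (c * 4 ^ i) (([:0, 1:] * [:1, 1:]) ^ i * [:1, 2:] ^ d))"
  proof -
    have "fps_of_poly ([:0, 1:] ::real poly) oo step_var = fps_X * b"
      "fps_of_poly ([:1, 1:] ::real poly) oo step_var = 1 + fps_X * b"
      "fps_of_poly ([:1, 2:] ::real poly) oo step_var = 1 + 2 * (fps_X * b)"
      unfolding compose_step_var_linear
      by (simp_all only: fps_const_0_eq_0 fps_const_1_eq_1 numeral_fps_const[symmetric]
          step_var_def defs mult_1_left add_0_left)
    moreover have "fps_const (c * 4 ^ i) = fps_const c * 4 ^ i"
      unfolding numeral_fps_const[of "num.Bit0 (num.Bit0 num.One)"]
      by (simp only: fps_const_mult fps_const_power)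
    ultimately show ?thesis
      by (simp only: newton_series_def fps_of_poly_smult fps_of_poly_mult fps_of_poly_power
          fps_compose_mult_distrib[OF step_var_0] fps_compose_power[OF step_var_0, symmetric]
          fps_const_compose numeral_compose defs mult.assoc)
  qed
  finally show ?thesis unfolding dd .
qed

lemma newton_series_linear:
  "newton_series (p + q) = newton_series p + newton_series q" "newton_series 0 = 0"
  by (simp_all add: newton_series_def fps_of_poly_add fps_compose_add_distrib algebra_simps)

text \<open>
  The coefficient of \<open>y\<^sup>i\<close> vanishes unless \<open>i \<le> m\<close> and \<open>i \<le> n\<close>, which gives \<open>2 i \<le> m + n\<close>.
\<close>

lemma ehrhart_series_gamma_poly:
  "\<exists>r. ehrhart_series (m + n) (gamma_poly m n) = newton_series r"
proof -
  have sum: "\<exists>r. ehrhart_series (m + n) (\<Sum>i\<in>I. monom (c i) i) = newton_series r"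
    if "finite I" "\<And>i. i \<in> I \<Longrightarrow> 2 * i \<le> m + n + 1 \<or> c i = 0" for I and c :: "nat \<Rightarrow> real"
    using that
  proof (induction I rule: finite_induct)
    case empty
    show ?case
      by (rule exI[of _ 0]) (simp add: newton_series_linear ehrhart_series_def gamma_series_def)
  next
    case (insert i I)
    then obtain r where r: "ehrhart_series (m + n) (\<Sum>i\<in>I. monom (c i) i) = newton_series r" by auto
    show ?case
    proof (cases "c i = 0")
      case True
      then show ?thesis using r insert.hyps by auto
    next
      case False
      with insert.prems have "2 * i \<le> m + n + 1" by auto
      from ehrhart_series_monom[OF this] r insert.hyps show ?thesis
        by (auto simp: ehrhart_series_linear newton_series_linear(1)[symmetric])
    qed
  qed
  show ?thesis unfolding gamma_poly_def
    by (rule sum) (auto simp: not_le binomial_eq_0)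
qed

lemma poly_ehrhart_K:
  "poly (ehrhart_K (Suc m) (Suc n)) (real k) = fps_nth (ehrhart_series (m + n) (gamma_poly m n)) k"
proof -
  let ?P = "bipartite_polytope (Suc m) (Suc n)"
  obtain r where r: "ehrhart_series (m + n) (gamma_poly m n) = newton_series r"
    using ehrhart_series_gamma_poly by blast
  obtain q where q: "\<And>k. poly q (real k) = fps_nth (newton_series r) k"
    using newton_series_polynomial by blast
  then have "is_ehrhart_polynomial ?P q"
    unfolding is_ehrhart_polynomial_def card_lattice_points r by blast
  then have "is_ehrhart_polynomial ?P (ehrhart_K (Suc m) (Suc n))"
    unfolding ehrhart_K_def ehrhart_polynomial_def
    by (rule theI) (erule is_ehrhart_polynomial_unique, fact)
  then show ?thesis
    unfolding is_ehrhart_polynomial_def card_lattice_points by blast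
qed

section \<open>The linear relation\<close>

lemma poly_eqI_nat:
  fixes p q :: "real poly"
  assumes "\<And>k::nat. poly p (real k) = poly q (real k)"
  shows "p = q"
proof (rule poly_eqI_degree)
  show "poly p x = poly q x" if "x \<in> real ` {..degree p + degree q}" for x
    using that assms by auto
qed (simp_all add: card_image)

lemma degree_gamma_poly: "degree (gamma_poly m n) \<le> m"
  by (rule degree_le) (simp add: coeff_gamma_poly binomial_eq_0)

lemma coeff_gamma_poly_top:
  assumes "m \<le> n"
  shows "coeff (gamma_poly m n) m \<noteq> 0"
  using assms by (simp add: coeff_gamma_poly)

lemma poly_gamma_poly_1_pos: "0 < poly (gamma_poly m n) 1"
proof -
  let ?c = "\<lambda>i. real ((2 * i choose i) * (m choose i) * (n choose i)) / 4 ^ i"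
  have "0 < ?c 0" by simp
  also have "?c 0 \<le> (\<Sum>i\<le>m. ?c i)" by (rule member_le_sum) auto
  also have "\<dots> = poly (gamma_poly m n) 1" by (simp add: gamma_poly_def poly_sum poly_monom)
  finally show ?thesis .
qed

lemma degree_ehrhart_op:
  assumes "degree p \<le> m"
  shows "degree (ehrhart_op N p) \<le> Suc m"
proof (rule degree_le, intro allI impI)
  fix i assume "Suc m < i"
  then obtain j where "i = Suc j" "m < j" by (cases i) auto
  moreover have "coeff p l = 0" if "m < l" for l
    using that assms by (intro coeff_eq_0) simp
  ultimately show "coeff (ehrhart_op N p) i = 0"
    by (simp add: ehrhart_op_def coeff_gamma_op)
qed

lemma poly_ehrhart_op_1: "poly (ehrhart_op N p) 1 = (real N + 2) * poly p 1"
  by (simp add: ehrhart_op_def gamma_op_def algebra_simps)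

text \<open>
  Subtracting the multiple of \<open>r d\<close> that cancels the top coefficient lowers the degree of \<open>q\<close>.
\<close>

lemma graded_basis:
  fixes r :: "nat \<Rightarrow> 'a::field poly"
  assumes "\<And>j. j \<le> d \<Longrightarrow> degree (r j) \<le> j \<and> coeff (r j) j \<noteq> 0" and "degree q \<le> d"
  shows "\<exists>a. q = (\<Sum>j\<le>d. smult (a j) (r j))"
  using assms
proof (induction d arbitrary: q)
  case 0
  have "degree q = 0" "degree (r 0) = 0" "coeff (r 0) 0 \<noteq> 0" using 0 by auto
  then obtain x y where "q = [:x:]" "r 0 = [:y:]" "y \<noteq> 0"
    by (metis coeff_pCons_0 degree_0_id)
  then show ?case by (intro exI[of _ "\<lambda>_. x / y"]) simp
next
  case (Suc d)
  define c where "c = coeff q (Suc d) / coeff (r (Suc d)) (Suc d)"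
  define p where "p = q - smult c (r (Suc d))"
  have "coeff p i = 0" if "d < i" for i
  proof (cases "i = Suc d")
    case True
    then show ?thesis using Suc.prems(1)[of "Suc d"] by (simp add: p_def c_def)
  next
    case False
    with that have "degree q < i" "degree (r (Suc d)) < i"
      using Suc.prems(1)[of "Suc d"] Suc.prems(2) by auto
    then show ?thesis by (simp add: p_def coeff_eq_0)
  qed
  then have "degree p \<le> d" by (intro degree_le) auto
  from Suc.IH[OF _ this] Suc.prems(1) obtain a where a: "p = (\<Sum>j\<le>d. smult (a j) (r j))" by auto
  have "(\<Sum>j\<le>d. smult ((a(Suc d := c)) j) (r j)) = p"
    unfolding a by (rule sum.cong) auto
  then have "(\<Sum>j\<le>Suc d. smult ((a(Suc d := c)) j) (r j)) = p + smult c (r (Suc d))"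
    by simp
  also have "\<dots> = q" by (simp add: p_def)
  finally show ?case by (intro exI[of _ "a(Suc d := c)"]) (rule sym)
qed

text \<open>
  The scalar \<open>\<alpha>\<close> is forced by evaluation at \<open>y = 1\<close>, where the second summand vanishes and the operator
  acts as a positive factor. The remainder is divisible by \<open>1 - y\<close>, and \<open>m \<le> n\<close> guarantees that the
  polynomials in the sum have full degree and so span all quotients of degree at most \<open>m\<close>.
\<close>

lemma gamma_poly_decomposition:
  assumes "m \<le> n"
  shows "\<exists>\<alpha> a. gamma_poly (Suc m) (Suc n) = smult \<alpha> (ehrhart_op (m + Suc n) (gamma_poly m (Suc n)))
     + [:1, -1:] * (\<Sum>i=0..m. smult (a i) (gamma_poly (m - i) (n + i)))"
proof -
  let ?L = "ehrhart_op (m + Suc n) (gamma_poly m (Suc n))"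
  have nz: "poly ?L 1 \<noteq> 0"
    using poly_gamma_poly_1_pos[of m "Suc n"] by (simp add: poly_ehrhart_op_1)
  define \<alpha> where "\<alpha> = poly (gamma_poly (Suc m) (Suc n)) 1 / poly ?L 1"
  define D where "D = gamma_poly (Suc m) (Suc n) - smult \<alpha> ?L"
  have "poly D 1 = 0" using nz by (simp add: D_def \<alpha>_def)
  then obtain q' where q': "D = [:-1, 1:] * q'" unfolding poly_eq_0_iff_dvd by (auto elim: dvdE)
  define q where "q = - q'"
  have q: "D = [:1, -1:] * q" by (simp add: q' q_def)
  have degD: "degree D \<le> Suc m"
    unfolding D_def using degree_gamma_poly[of "Suc m" "Suc n"]
      degree_ehrhart_op[OF degree_gamma_poly[of m "Suc n"], of "m + Suc n"]
    by (intro degree_diff_le) (auto intro: order.trans[OF degree_smult_le])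
  have "degree q \<le> m"
  proof (cases "q = 0")
    case False
    then have "degree D = Suc (degree q)" unfolding q by (subst degree_mult_eq) auto
    then show ?thesis using degD by simp
  qed simp
  have "\<exists>b. q = (\<Sum>j\<le>m. smult (b j) (gamma_poly j (n + (m - j))))"
  proof (rule graded_basis)
    fix j assume "j \<le> m"
    then have "j \<le> n + (m - j)" using assms by simp
    then show "degree (gamma_poly j (n + (m - j))) \<le> j \<and> coeff (gamma_poly j (n + (m - j))) j \<noteq> 0"
      using degree_gamma_poly coeff_gamma_poly_top by blast
  qed fact
  then obtain b where "q = (\<Sum>j\<le>m. smult (b j) (gamma_poly j (n + (m - j))))" by blast
  also have "\<dots> = (\<Sum>i=0..m. smult (b (m - i)) (gamma_poly (m - i) (n + i)))"
    by (rule sum.reindex_bij_witness[where i = "\<lambda>j. m - j" and j = "\<lambda>j. m - j"]) auto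
  finally have sum: "q = (\<Sum>i=0..m. smult (b (m - i)) (gamma_poly (m - i) (n + i)))" .
  have "gamma_poly (Suc m) (Suc n) = smult \<alpha> ?L + D" by (simp add: D_def)
  also have "D = [:1, -1:] * (\<Sum>i=0..m. smult (b (m - i)) (gamma_poly (m - i) (n + i)))"
    by (simp only: q flip: sum)
  finally show ?thesis by (intro exI[of _ \<alpha>] exI[of _ "\<lambda>i. b (m - i)"])
qed

lemma ehrhart_series_sum:
  "ehrhart_series N (\<Sum>i\<in>I. smult (a i) (f i)) = (\<Sum>i\<in>I. fps_const (a i) * ehrhart_series N (f i))"
proof (induction I rule: infinite_finite_induct)
  case (insert i I)
  then show ?case by (simp add: ehrhart_series_linear)
qed (simp_all add: ehrhart_series_def gamma_series_def)

lemma fps_nth_euler: "fps_nth (F + 2 * fps_X * fps_deriv F) k = (2 * real k + 1) * fps_nth F k"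
  for F :: "real fps"
proof -
  have two: "(2 :: real fps) = fps_const 2" by (rule numeral_fps_const)
  have "2 * fps_X * fps_deriv F = fps_const 2 * (fps_X * fps_deriv F)"
    unfolding two by (rule mult.assoc)
  then have "fps_nth (F + 2 * fps_X * fps_deriv F) k = fps_nth F k + 2 * fps_nth (fps_X * fps_deriv F) k"
    by (simp only: fps_add_nth fps_mult_left_const_nth)
  also have "fps_nth (fps_X * fps_deriv F) k = real k * fps_nth F k"
    by (cases k) simp_all
  finally show ?thesis by (simp add: algebra_simps)
qed

theorem corollary4p5:
  fixes n :: nat
  assumes "n \<ge> 1"
  shows "\<forall>m::nat. 1 \<le> m \<and> m \<le> n \<longrightarrow>
    (\<exists>(\<alpha>::real) (a::nat \<Rightarrow> real).
       ehrhart_K (m + 1) (n + 1) =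
         [:1, 2:] * smult \<alpha> (ehrhart_K m (n + 1)) +
         (\<Sum>i=0..m - 1. smult (a i) (ehrhart_K (m - i) (n + i))))"
proof (intro allI impI, elim conjE)
  fix m :: nat assume "1 \<le> m" "m \<le> n"
  define M N where "M = m - 1" and "N = n - 1"
  with \<open>1 \<le> m\<close> \<open>m \<le> n\<close> have m: "m = Suc M" and n: "n = Suc N" and "M \<le> N" by auto
  from gamma_poly_decomposition[OF \<open>M \<le> N\<close>] obtain \<alpha> a where
    dec: "gamma_poly (Suc M) (Suc N) = smult \<alpha> (ehrhart_op (M + Suc N) (gamma_poly M (Suc N)))
     + [:1, -1:] * (\<Sum>i=0..M. smult (a i) (gamma_poly (M - i) (N + i)))" by blast
  let ?G = "\<lambda>i j. ehrhart_series (i + j) (gamma_poly i j)"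
  have "?G (Suc M) (Suc N) = fps_const \<alpha> * (?G M (Suc N) + 2 * fps_X * fps_deriv (?G M (Suc N)))
     + (\<Sum>i=0..M. fps_const (a i) * ?G (M - i) (N + i))"
  proof -
    have "ehrhart_series (M + N + 2) ([:1, -1:] * (\<Sum>i=0..M. smult (a i) (gamma_poly (M - i) (N + i))))
      = (\<Sum>i=0..M. fps_const (a i) * ?G (M - i) (N + i))"
      unfolding ehrhart_series_shift ehrhart_series_sum by (intro sum.cong refl) simp
    then show ?thesis
      unfolding dec ehrhart_series_linear ehrhart_series_deriv by simp
  qed
  note series = this
  have nth: "fps_nth (?G (Suc M) (Suc N)) k = \<alpha> * ((2 * real k + 1) * fps_nth (?G M (Suc N)) k)
     + (\<Sum>i=0..M. a i * fps_nth (?G (M - i) (N + i)) k)" for k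
  proof -
    have "fps_nth (?G (Suc M) (Suc N)) k
      = fps_nth (fps_const \<alpha> * (?G M (Suc N) + 2 * fps_X * fps_deriv (?G M (Suc N)))) k
        + fps_nth (\<Sum>i=0..M. fps_const (a i) * ?G (M - i) (N + i)) k"
      unfolding series by (rule fps_add_nth)
    also have "fps_nth (fps_const \<alpha> * (?G M (Suc N) + 2 * fps_X * fps_deriv (?G M (Suc N)))) k
      = \<alpha> * ((2 * real k + 1) * fps_nth (?G M (Suc N)) k)"
      unfolding fps_mult_left_const_nth fps_nth_euler ..
    also have "fps_nth (\<Sum>i=0..M. fps_const (a i) * ?G (M - i) (N + i)) k
      = (\<Sum>i=0..M. a i * fps_nth (?G (M - i) (N + i)) k)"
      unfolding fps_sum_nth fps_mult_left_const_nth ..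
    finally show ?thesis .
  qed
  have "ehrhart_K (m + 1) (n + 1) = [:1, 2:] * smult \<alpha> (ehrhart_K m (n + 1))
      + (\<Sum>i=0..m - 1. smult (a i) (ehrhart_K (m - i) (n + i)))"
  proof (rule poly_eqI_nat)
    fix k
    have lhs: "poly (ehrhart_K (m + 1) (n + 1)) (real k) = fps_nth (?G (Suc M) (Suc N)) k"
      unfolding m n Suc_eq_plus1[symmetric] by (rule poly_ehrhart_K)
    have first: "poly (ehrhart_K m (n + 1)) (real k) = fps_nth (?G M (Suc N)) k"
      unfolding m n Suc_eq_plus1[symmetric] by (rule poly_ehrhart_K)
    have rest: "(\<Sum>i=0..m - 1. a i * poly (ehrhart_K (m - i) (n + i)) (real k))
      = (\<Sum>i=0..M. a i * fps_nth (?G (M - i) (N + i)) k)"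
    proof (rule sum.cong)
      fix i assume "i \<in> {0..M}"
      then have "m - i = Suc (M - i)" "n + i = Suc (N + i)" using m n by auto
      then show "a i * poly (ehrhart_K (m - i) (n + i)) (real k) = a i * fps_nth (?G (M - i) (N + i)) k"
        by (simp only: poly_ehrhart_K)
    qed (simp add: m)
    have factor: "poly [:1, 2:] (real k) = 2 * real k + 1" by simp
    show "poly (ehrhart_K (m + 1) (n + 1)) (real k) = poly ([:1, 2:] * smult \<alpha> (ehrhart_K m (n + 1))
      + (\<Sum>i=0..m - 1. smult (a i) (ehrhart_K (m - i) (n + i)))) (real k)"
      unfolding lhs nth poly_add poly_mult poly_smult poly_sum first rest factor
      by (simp only: mult.left_commute)
  qed
  then show "\<exists>(\<alpha>::real) (a::nat \<Rightarrow> real).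
       ehrhart_K (m + 1) (n + 1) =
         [:1, 2:] * smult \<alpha> (ehrhart_K m (n + 1)) +
         (\<Sum>i=0..m - 1. smult (a i) (ehrhart_K (m - i) (n + i)))" by blast
qed

end
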